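(* For every $\alpha>0$, let $\mathcal{C}_\alpha=X_\alpha(\mathbb{R}^2)\subset \mathrm{Nil}_3$ be the surface defined in the context. Then $\mathcal{C}_\alpha$ is a minimal annulus in $\mathrm{Nil}_3$ with the following properties. 1. For every $c\in\mathbb{R}$, the intersection of $\mathcal{C}_\alpha$ with the vertical plane $\{x_2=c\}$ is a non-empty, closed, embedded, convex curve. Here convexity is meant in the flat plane $\{x_2=c\}$, whose induced metric in the coordinates $(x_1,\,x_3+\tfrac{c}{2}x_1)$ is Euclidean. 2. $\mathcal{C}_\alpha$ is properly embedded. 3. $\mathcal{C}_\alpha$ is invariant under each of the three isometries $(x_1,x_2,x_3)\mapsto(x_1,-x_2,-x_3)$, $(x_1,x_2,x_3)\mapsto(-x_1,x_2,-x_3)$ and $(x_1,x_2,x_3)\mapsto(-x_1,-x_2,x_3)$. These are the rotations of angle $\pi$ around the $x_1$-, $x_2$- and $x_3$-axes. Moreover, the $x_2$-axis is contained in the "interior" of $\mathcal{C}_\alpha$: for each $c$, the point $(0,c,0)$ lies in the bounded region of the plane $\{x_2=c\}$ enclosed by the curve $\mathcal{C}_\alpha\cap\{x_2=c\}$. 4. $\mathcal{C}_\alpha$ is conformally equivalent to $\mathbb{C}\setminus\{0\}$.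
   Context: $\mathrm{Nil}_3$ is $\mathbb{R}^3$ with coordinates $(x_1,x_2,x_3)$ and the Riemannian metric $dx_1^2+dx_2^2+\big(dx_3+\tfrac12(x_2\,dx_1-x_1\,dx_2)\big)^2$. A vertical plane is a surface $\{a_1x_1+a_2x_2=b\}$ with $(a_1,a_2)\neq(0,0)$. For $\alpha>0$ and $\theta\in\mathbb{R}$ set $C_{\alpha,\theta}=\frac{\sin(2\theta)}{2\alpha}$ and $P_{\alpha,\theta}(x)=\alpha^2+\cos(2\theta)x^2-C_{\alpha,\theta}^2x^4$. Let $\theta^+_\alpha=\pi/2$ if $\alpha>1$, and $\theta^+_\alpha=\frac12\arccos(1-2\alpha^2)$ if $\alpha\le1$. Set $$L(\alpha,\theta)=\int_{-1}^1\frac{2\alpha C_{\alpha,\theta}^2x^2-\alpha\cos(2\theta)+C_{\alpha,\theta}^2x^2\sqrt{P_{\alpha,\theta}(x)}}{\sqrt{(1-x^2)P_{\alpha,\theta}(x)}\,\big(\alpha+\sqrt{P_{\alpha,\theta}(x)}\big)}\,dx .$$ Let $\theta=\tilde\theta_\alpha$ be the unique $\theta\in(0,\theta^+_\alpha)\cap(0,\pi/4)$ with $L(\alpha,\theta)=0$, and write $C=C_{\alpha,\tilde\theta_\alpha}$. Let $\varphi:\mathbb{R}\to\mathbb{R}$ be the solution of $\varphi'^2=P_{\alpha,\theta}(\cos\varphi)$ with $\varphi(0)=0$ and $\varphi'(0)\le0$. Define functions by $\beta'=C\cos^2\varphi$ with $\beta(0)=0$, and $G'=\frac{C^2\cos^2\varphi-\cos(2\theta)}{\alpha-\varphi'}$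 with $G(0)=0$. For $(u,v)\in\mathbb{R}^2$ put $A=\alpha v+\beta(u)$, and define $X_\alpha(u,v)=(x_1,x_2,x_3)$ by $x_1=\frac{G'(u)}{\alpha}\cos\varphi(u)\sinh A-\frac{C}{\alpha}\sin\varphi(u)\cosh A$, $x_2=Cv-G(u)$, $x_3=-\frac{x_1x_2}{2}+\frac{C}{\alpha}\Big(\frac{G'(u)}{\alpha}-1\Big)\cos\varphi(u)\cosh A-\frac1\alpha\Big(\frac{C^2}{\alpha}+G'(u)\Big)\sin\varphi(u)\sinh A$. The surface $\mathcal{C}_\alpha$ (called the horizontal catenoid of parameter $\alpha$) is the image of $X_\alpha$. *)

theory Defs
  imports "HOL-Analysis.Analysis"
begin

text \<open>Points of Nil_3 are vectors p in real^3 with coordinates p$1, p$2, p$3 (= x1, x2, x3).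
  The metric dx1^2 + dx2^2 + (dx3 + (x2 dx1 - x1 dx2)/2)^2 evaluated at p on tangent vectors a, b.\<close>

definition nil_form :: "real^3 \<Rightarrow> real^3 \<Rightarrow> real" where
  "nil_form p a = a$3 + (p$2 * a$1 - p$1 * a$2) / 2"

definition nil_metric :: "real^3 \<Rightarrow> real^3 \<Rightarrow> real^3 \<Rightarrow> real" where
  "nil_metric p a b = a$1 * b$1 + a$2 * b$2 + nil_form p a * nil_form p b"

definition nil_g :: "real^3 \<Rightarrow> 3 \<Rightarrow> 3 \<Rightarrow> real" where
  "nil_g p i j = nil_metric p (axis i 1) (axis j 1)"

definition nil_dg :: "3 \<Rightarrow> real^3 \<Rightarrow> 3 \<Rightarrow> 3 \<Rightarrow> real" where
  "nil_dg l p i j = deriv (\<lambda>t. nil_g (p + t *\<^sub>R axis l 1) i j) 0"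

definition nil_christoffel1 :: "real^3 \<Rightarrow> 3 \<Rightarrow> 3 \<Rightarrow> 3 \<Rightarrow> real" where
  "nil_christoffel1 p l i j = (nil_dg i p j l + nil_dg j p i l - nil_dg l p i j) / 2"

definition D1 :: "(complex \<Rightarrow> 'b::real_normed_vector) \<Rightarrow> complex \<Rightarrow> 'b" where
  "D1 F z = frechet_derivative F (at z) 1"

definition D2 :: "(complex \<Rightarrow> 'b::real_normed_vector) \<Rightarrow> complex \<Rightarrow> 'b" where
  "D2 F z = frechet_derivative F (at z) \<i>"

definition C2_on :: "complex set \<Rightarrow> (complex \<Rightarrow> real^3) \<Rightarrow> bool" where
  "C2_on U F \<longleftrightarrow> open U \<and>
     (\<forall>z\<in>U. F differentiable (at z) \<and> D1 F differentiable (at z) \<and> D2 F differentiable (at z)) \<and>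
     continuous_on U (D1 (D1 F)) \<and> continuous_on U (D2 (D1 F)) \<and>
     continuous_on U (D1 (D2 F)) \<and> continuous_on U (D2 (D2 F))"

definition nil_conformal_immersion :: "complex set \<Rightarrow> (complex \<Rightarrow> real^3) \<Rightarrow> bool" where
  "nil_conformal_immersion U F \<longleftrightarrow> C2_on U F \<and>
     (\<forall>z\<in>U. nil_metric (F z) (D1 F z) (D1 F z) > 0 \<and>
            nil_metric (F z) (D1 F z) (D1 F z) = nil_metric (F z) (D2 F z) (D2 F z) \<and>
            nil_metric (F z) (D1 F z) (D2 F z) = 0)"

text \<open>Covariant second derivative nabla_{d_a} d_b F (index lowered with the metric),
  for a, b in {1,2} encoded by the operators Da, Db.\<close>
definition nil_hess_low ::
  "(complex \<Rightarrow> real^3) \<Rightarrow> ((complex \<Rightarrow> real^3) \<Rightarrow> complex \<Rightarrow> real^3) \<Rightarrow>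
   ((complex \<Rightarrow> real^3) \<Rightarrow> complex \<Rightarrow> real^3) \<Rightarrow> complex \<Rightarrow> 3 \<Rightarrow> real" where
  "nil_hess_low F Da Db z l =
     (\<Sum>k\<in>UNIV. nil_g (F z) l k * Da (Db F) z $ k) +
     (\<Sum>i\<in>UNIV. \<Sum>j\<in>UNIV. nil_christoffel1 (F z) l i j * Da F z $ i * Db F z $ j)"

text \<open>Mean curvature covector (up to the positive factor 1/(2 det h)): with first fundamental form
  h_ab, it is h22 nabla_1 d_1 F - 2 h12 nabla_1 d_2 F + h11 nabla_2 d_2 F; the surface is minimal
  iff its normal part vanishes, i.e. it annihilates all vectors normal to the surface.\<close>
definition nil_mean_curv_low :: "(complex \<Rightarrow> real^3) \<Rightarrow> complex \<Rightarrow> 3 \<Rightarrow> real" where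
  "nil_mean_curv_low F z l =
     nil_metric (F z) (D2 F z) (D2 F z) * nil_hess_low F D1 D1 z l
     - 2 * nil_metric (F z) (D1 F z) (D2 F z) * nil_hess_low F D1 D2 z l
     + nil_metric (F z) (D1 F z) (D1 F z) * nil_hess_low F D2 D2 z l"

definition nil_minimal :: "complex set \<Rightarrow> (complex \<Rightarrow> real^3) \<Rightarrow> bool" where
  "nil_minimal U F \<longleftrightarrow>
     (\<forall>z\<in>U. \<forall>N::real^3. nil_metric (F z) (D1 F z) N = 0 \<and> nil_metric (F z) (D2 F z) N = 0 \<longrightarrow>
        (\<Sum>l\<in>UNIV. nil_mean_curv_low F z l * N $ l) = 0)"

definition proper_map_on :: "complex set \<Rightarrow> (complex \<Rightarrow> real^3) \<Rightarrow> bool" where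
  "proper_map_on U F \<longleftrightarrow> (\<forall>K. compact K \<longrightarrow> compact {z\<in>U. F z \<in> K})"

definition hc_C :: "real \<Rightarrow> real \<Rightarrow> real" where
  "hc_C \<alpha> \<theta> = sin (2 * \<theta>) / (2 * \<alpha>)"

definition hc_P :: "real \<Rightarrow> real \<Rightarrow> real \<Rightarrow> real" where
  "hc_P \<alpha> \<theta> x = \<alpha>^2 + cos (2 * \<theta>) * x^2 - (hc_C \<alpha> \<theta>)^2 * x^4"

definition hc_theta_plus :: "real \<Rightarrow> real" where
  "hc_theta_plus \<alpha> = (if \<alpha> > 1 then pi / 2 else arccos (1 - 2 * \<alpha>^2) / 2)"

definition hc_L :: "real \<Rightarrow> real \<Rightarrow> real" where
  "hc_L \<alpha> \<theta> = integral {-1..1} (\<lambda>x.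
     (2 * \<alpha> * (hc_C \<alpha> \<theta>)^2 * x^2 - \<alpha> * cos (2 * \<theta>) + (hc_C \<alpha> \<theta>)^2 * x^2 * sqrt (hc_P \<alpha> \<theta> x))
     / (sqrt ((1 - x^2) * hc_P \<alpha> \<theta> x) * (\<alpha> + sqrt (hc_P \<alpha> \<theta> x))))"

definition hc_theta :: "real \<Rightarrow> real" where
  "hc_theta \<alpha> = (THE \<theta>. 0 < \<theta> \<and> \<theta> < hc_theta_plus \<alpha> \<and> \<theta> < pi / 4 \<and> hc_L \<alpha> \<theta> = 0)"

definition hc_CC :: "real \<Rightarrow> real" where
  "hc_CC \<alpha> = hc_C \<alpha> (hc_theta \<alpha>)"

definition hc_phi :: "real \<Rightarrow> real \<Rightarrow> real" where
  "hc_phi \<alpha> = (SOME \<phi>. \<phi> 0 = 0 \<and> (\<forall>u. \<phi> differentiable (at u)) \<and>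
      (\<forall>u. (deriv \<phi> u)^2 = hc_P \<alpha> (hc_theta \<alpha>) (cos (\<phi> u))) \<and> deriv \<phi> 0 \<le> 0)"

definition hc_beta :: "real \<Rightarrow> real \<Rightarrow> real" where
  "hc_beta \<alpha> = (SOME \<beta>. \<beta> 0 = 0 \<and>
      (\<forall>u. (\<beta> has_real_derivative hc_CC \<alpha> * (cos (hc_phi \<alpha> u))^2) (at u)))"

definition hc_Gp :: "real \<Rightarrow> real \<Rightarrow> real" where
  "hc_Gp \<alpha> u = ((hc_CC \<alpha>)^2 * (cos (hc_phi \<alpha> u))^2 - cos (2 * hc_theta \<alpha>))
                 / (\<alpha> - deriv (hc_phi \<alpha>) u)"

definition hc_G :: "real \<Rightarrow> real \<Rightarrow> real" where
  "hc_G \<alpha> = (SOME G. G 0 = 0 \<and> (\<forall>u. (G has_real_derivative hc_Gp \<alpha> u) (at u)))"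

definition hc_X :: "real \<Rightarrow> real \<Rightarrow> real \<Rightarrow> real^3" where
  "hc_X \<alpha> u v =
    (let C = hc_CC \<alpha>; \<phi> = hc_phi \<alpha> u; Gp = hc_Gp \<alpha> u; A = \<alpha> * v + hc_beta \<alpha> u;
         x1 = Gp / \<alpha> * cos \<phi> * sinh A - C / \<alpha> * sin \<phi> * cosh A;
         x2 = C * v - hc_G \<alpha> u;
         x3 = - (x1 * x2) / 2 + C / \<alpha> * (Gp / \<alpha> - 1) * cos \<phi> * cosh A
              - 1 / \<alpha> * (C^2 / \<alpha> + Gp) * sin \<phi> * sinh A
     in vector [x1, x2, x3])"

definition horizontal_catenoid :: "real \<Rightarrow> (real^3) set" where
  "horizontal_catenoid \<alpha> = {hc_X \<alpha> u v | u v. True}"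

text \<open>Euclidean coordinates (x1, x3 + c x1 / 2) on the vertical plane {x2 = c}, and the
  section of a set S by that plane expressed in these coordinates.\<close>
definition plane_coords :: "real \<Rightarrow> real^3 \<Rightarrow> real \<times> real" where
  "plane_coords c p = (p$1, p$3 + c / 2 * p$1)"

definition vslice :: "real \<Rightarrow> (real^3) set \<Rightarrow> (real \<times> real) set" where
  "vslice c S = plane_coords c ` (S \<inter> {p. p$2 = c})"

end

theory Submission
  imports Defs
begin

text \<open>Write \<open>x = cos \<phi>\<close>, \<open>g = G'\<close> and \<open>c = cos (2 \<theta>)\<close>. Then \<open>x\<^sup>2 g = \<alpha> + \<phi>'\<close> and \<open>g' = (g\<^sup>2 + C\<^sup>2) x sin \<phi>\<close>, so that
  \<open>\<phi>, g, \<beta>, G\<close> solve a polynomial system, from which \<open>X\<^sub>\<alpha>\<close> is checked to be conformal and harmonic.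
  The condition \<open>L = 0\<close> says exactly that \<open>\<alpha> G + C \<beta>\<close> returns to its initial value when \<open>\<phi>\<close> changes by \<open>\<pi>\<close>;
  hence \<open>X\<^sub>\<alpha>\<close> is invariant under a translation of the \<open>(u, v)\<close>-plane and descends along an exponential to
  \<open>\<complex> - {0}\<close>. The section by \<open>x\<^sub>2 = c\<close>, parametrized by \<open>u\<close>, has velocity a positive multiple of
  \<open>(cos \<phi>, - sin \<phi>)\<close>: its tangent turns monotonically, once around per period, so it bounds a convex
  region. The same parametrization gives injectivity, and \<open>x\<^sub>2 = C v - G\<close> bounds \<open>v\<close>, which gives
  properness.\<close>

subsection \<open>The period integral\<close>

text \<open>The relation \<open>x\<^sup>2 g = \<alpha> + \<phi>'\<close> comes from
  \<open>\<alpha>\<^sup>2 - P x = x\<^sup>2 (C\<^sup>2 x\<^sup>2 - c)\<close>. It eliminates the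
  square root of \<open>P\<close>, so the identities for \<open>X\<close> become polynomial in
  \<open>g\<close>, sine, cosine, \<open>sinh A\<close> and \<open>cosh A\<close>. The angle and the
  profile functions are given by \<open>THE\<close> and \<open>SOME\<close>, so their existence is
  part of the work. \<open>L\<close> is strictly increasing in \<theta> and negative at 0; the
  obstacle is to find a positive value. If \<open>2 \<alpha>\<^sup>2 > 1\<close>, then
  \<open>pi / 4\<close> is admissible and serves; otherwise
  \<open>\<theta>\<^sup>+ \<le> pi / 4\<close>, and only the degeneration at the right end makes
  \<open>L\<close> positive. \<open>\<phi>\<close> inverts the time function \<open>T\<close> with
  \<open>T' p = 1 / sqrt (P (cos p))\<close>, whose parity and shift law show that
  \<open>\<phi>\<close> is odd and falls by \<open>pi\<close> over \<open>h = T pi\<close>. With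
  \<open>b = \<beta> h\<close>, the shift by \<open>(h, - b / \<alpha>)\<close> fixes
  \<open>A\<close>; the condition on \<open>\<alpha> G + C \<beta>\<close> is exactly what makes the
  same shift fix \<open>x\<^sub>2\<close>. It reverses the sign of both plane coordinates. So half a
  period already is a symmetry, the rotation about the \<open>x\<^sub>2\<close>-axis, and it makes
  every section centrally symmetric.\<close>

lemma real_antiderivative:
  fixes f :: "real \<Rightarrow> real"
  assumes "\<And>x. isCont f x"
  obtains F where "F 0 = 0" "\<And>x. (F has_real_derivative f x) (at x)"
proof -
  obtain F where F: "\<And>x. (F has_real_derivative f x) (at x)"
    using einterval_antiderivative[of "-\<infinity>" "\<infinity>" f] assms
    by (auto simp: has_real_derivative_iff_has_vector_derivative)
  have "((\<lambda>x. F x - F 0) has_real_derivative f x) (at x)" for x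
    using DERIV_diff[OF F DERIV_const] by simp
  then show ?thesis
    using that[of "\<lambda>x. F x - F 0"] by simp
qed

lemma DERIV_eq_imp_diff_const:
  fixes F G :: "real \<Rightarrow> real"
  assumes "\<And>x. (F has_real_derivative f x) (at x)" "\<And>x. (G has_real_derivative f x) (at x)"
  shows "F x - F y = G x - G y"
proof -
  have "((\<lambda>x. F x - G x) has_real_derivative 0) (at x)" for x
    using DERIV_diff[OF assms] by simp
  then have "F x - G x = F y - G y"
    using DERIV_isconst_all[of "\<lambda>x. F x - G x"] by blast
  then show ?thesis by simp
qed

text \<open>The integrand is unbounded at both ends. With \<open>K' p = f (cos p)\<close>, the
  antiderivative \<open>- K (arccos x)\<close> is continuous on the closed interval and
  differentiable inside it, which is all that the interior form of the fundamental theorem asks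
  for.\<close>

lemma has_integral_cos_substitution:
  fixes f :: "real \<Rightarrow> real"
  assumes f: "continuous_on {-1..1} f"
  shows "((\<lambda>x. f x / sqrt (1 - x^2)) has_integral integral {0..pi} (\<lambda>p. f (cos p))) {-1..1}"
proof -
  have c: "isCont (\<lambda>p. f (cos p)) p" for p
  proof -
    have "continuous_on UNIV (\<lambda>p. f (cos p))"
      by (rule continuous_on_compose2[OF f]) (auto intro: continuous_intros)
    then show ?thesis by (simp add: continuous_on_eq_continuous_at)
  qed
  obtain K where K: "\<And>p. (K has_real_derivative f (cos p)) (at p)"
    by (rule real_antiderivative[OF c]) (rule that)
  have "((\<lambda>p. f (cos p)) has_integral K pi - K 0) {0..pi}"
    by (rule fundamental_theorem_of_calculus)
      (use K in \<open>auto simp: has_real_derivative_iff_has_vector_derivative[symmetric]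
        intro: has_field_derivative_at_within\<close>)
  then have I: "integral {0..pi} (\<lambda>p. f (cos p)) = K pi - K 0"
    by (rule integral_unique)
  have contK: "continuous_on UNIV K"
    using K by (meson DERIV_continuous_on has_field_derivative_at_within)
  have "((\<lambda>x. f x / sqrt (1 - x^2)) has_integral (- K (arccos 1)) - (- K (arccos (-1)))) {-1..1}"
  proof (rule fundamental_theorem_of_calculus_interior)
    show "continuous_on {-1..1} (\<lambda>x. - K (arccos x))"
      by (intro continuous_intros continuous_on_compose2[OF contK] continuous_on_arccos') auto
    fix x :: real assume x: "x \<in> {-1<..<1}"
    have "((\<lambda>x. K (arccos x)) has_real_derivative f (cos (arccos x)) * inverse (- sqrt (1 - x\<^sup>2))) (at x)"
      by (rule DERIV_chain2[OF K]) (use x in \<open>auto intro!: DERIV_arccos simp del: inverse_minus_eq\<close>)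
    then have "((\<lambda>x. - K (arccos x)) has_real_derivative - (f (cos (arccos x)) * inverse (- sqrt (1 - x\<^sup>2)))) (at x)"
      by (rule DERIV_minus)
    also have "- (f (cos (arccos x)) * inverse (- sqrt (1 - x\<^sup>2))) = f x / sqrt (1 - x^2)"
      using x by (simp add: cos_arccos divide_inverse)
    finally show "((\<lambda>x. - K (arccos x)) has_vector_derivative f x / sqrt (1 - x^2)) (at x)"
      by (simp add: has_real_derivative_iff_has_vector_derivative)
  qed auto
  then show ?thesis by (simp add: I)
qed

section \<open>Positivity of \<open>P\<close> and \<open>L\<close> as the integral of a continuous
  function over [0, pi]\<close>

definition hc_f :: "real \<Rightarrow> real \<Rightarrow> real \<Rightarrow> real" where
  "hc_f \<alpha> \<theta> x =
     (2 * \<alpha> * (hc_C \<alpha> \<theta>)^2 * x^2 - \<alpha> * cos (2 * \<theta>) + (hc_C \<alpha> \<theta>)^2 * x^2 * sqrt (hc_P \<alpha> \<theta> x))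
     / (sqrt (hc_P \<alpha> \<theta> x) * (\<alpha> + sqrt (hc_P \<alpha> \<theta> x)))"

lemma hc_C_sq: "\<alpha> \<noteq> 0 \<Longrightarrow> (hc_C \<alpha> \<theta>)^2 = (1 - (cos (2*\<theta>))^2) / (4 * \<alpha>^2)"
  by (simp add: hc_C_def power_divide power_mult_distrib sin_squared_eq)

text \<open>As a function of \<open>y = x\<^sup>2\<close>, \<open>P\<close> is concave: it equals
  the linear interpolation of its values at 0 and 1 plus \<open>k * y * (1 - y)\<close>. The value
  at 1 is \<open>((c + 2 * \<alpha>^2)^2 - 1) / (4 * \<alpha>^2)\<close>, which is where the bound
  \<open>1 - 2 * \<alpha>^2 < c\<close>, and with it \<theta>-plus, comes from.\<close>

lemma hc_P_pos_aux:
  fixes \<alpha> c y :: real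
  assumes "\<alpha> > 0" "1 - 2 * \<alpha>^2 < c" "-1 \<le> c" "c \<le> 1" "0 \<le> y" "y \<le> 1"
  shows "\<alpha>^2 + c * y - (1 - c^2) / (4 * \<alpha>^2) * y^2 > 0"
proof -
  define k where "k = (1 - c^2) / (4 * \<alpha>^2)"
  have "c^2 \<le> 1" using assms by (simp add: abs_square_le_1)
  then have k: "k \<ge> 0" by (simp add: k_def)
  have "\<alpha>^2 + c - k = ((c + 2 * \<alpha>^2)^2 - 1) / (4 * \<alpha>^2)"
    using assms(1) by (simp add: k_def field_simps power2_eq_square)
  moreover have "(c + 2 * \<alpha>^2)^2 > 1"
    using assms by (intro one_less_power) auto
  ultimately have 1: "\<alpha>^2 + c - k > 0" using assms by simp
  have "\<alpha>^2 + c * y - k * y^2 = (1 - y) * \<alpha>^2 + y * (\<alpha>^2 + c - k) + k * y * (1 - y)"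
    by (simp add: algebra_simps power2_eq_square)
  also have "\<dots> > 0"
  proof (cases "y = 1")
    case False
    then show ?thesis using assms k 1 by (intro add_pos_nonneg) auto
  qed (use 1 in simp)
  finally show ?thesis by (simp add: k_def)
qed

lemma cos_gt_of_less_theta_plus:
  assumes "\<alpha> > 0" "0 \<le> \<theta>" "\<theta> < hc_theta_plus \<alpha>"
  shows "1 - 2 * \<alpha>^2 < cos (2 * \<theta>)"
proof (cases "\<alpha> > 1")
  case True
  then have "\<alpha>^2 > 1" by (intro one_less_power) auto
  then show ?thesis using cos_ge_minus_one[of "2*\<theta>"] by linarith
next
  case False
  then have a: "\<alpha>^2 \<le> 1" using assms by (simp add: abs_square_le_1)
  have "2 * \<theta> < arccos (1 - 2 * \<alpha>^2)"
    using assms False by (simp add: hc_theta_plus_def)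
  moreover have "arccos (1 - 2 * \<alpha>^2) \<le> pi" using a by (intro arccos_ubound) auto
  ultimately have "cos (arccos (1 - 2 * \<alpha>^2)) < cos (2 * \<theta>)"
    using assms by (intro cos_monotone_0_pi) auto
  then show ?thesis using a by (simp add: cos_arccos)
qed

lemma hc_P_pos:
  assumes "\<alpha> > 0" "0 \<le> \<theta>" "\<theta> < hc_theta_plus \<alpha>" "\<bar>x\<bar> \<le> 1"
  shows "hc_P \<alpha> \<theta> x > 0"
proof -
  have "\<alpha>^2 + cos (2*\<theta>) * x^2 - (1 - (cos (2*\<theta>))^2) / (4 * \<alpha>^2) * (x^2)^2 > 0"
    using assms cos_gt_of_less_theta_plus[OF assms(1-3)]
    by (intro hc_P_pos_aux) (auto simp: abs_square_le_1)
  then show ?thesis using assms(1) by (simp add: hc_P_def hc_C_sq)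
qed

text \<open>\<open>hc_f\<close> is the integrand of \<open>L\<close> without the factor
  \<open>1 / sqrt (1 - x^2)\<close>. After the substitution \<open>x = cos p\<close> the integral is
  no longer improper, so continuity and monotonicity in \<theta> can be read off pointwise.\<close>

lemma hc_L_eq:
  assumes "\<alpha> > 0" "0 \<le> \<theta>" "\<theta> < hc_theta_plus \<alpha>"
  shows "hc_L \<alpha> \<theta> = integral {0..pi} (\<lambda>p. hc_f \<alpha> \<theta> (cos p))"
proof -
  have *: "continuous_on {-1..1} (hc_f \<alpha> \<theta>)"
  proof -
    have "sqrt (hc_P \<alpha> \<theta> x) * (\<alpha> + sqrt (hc_P \<alpha> \<theta> x)) \<noteq> 0" if "x \<in> {-1..1}" for x
    proof -
      have "hc_P \<alpha> \<theta> x > 0" using hc_P_pos[OF assms, of x] that by auto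
      then have "sqrt (hc_P \<alpha> \<theta> x) > 0" by simp
      then show ?thesis using assms by (metis add_pos_pos less_irrefl mult_pos_pos)
    qed
    moreover have "continuous_on {-1..1} (\<lambda>x. hc_P \<alpha> \<theta> x)"
      unfolding hc_P_def by (intro continuous_intros)
    ultimately show ?thesis
      unfolding hc_f_def by (intro continuous_intros) auto
  qed
  show ?thesis
    unfolding hc_L_def
    by (rule integral_unique)
      (use has_integral_cos_substitution[OF *] in
        \<open>simp add: hc_f_def real_sqrt_mult divide_divide_eq_left' mult_ac\<close>)
qed

lemma continuous_hc_f:
  assumes "\<alpha> > 0" "\<And>\<theta>. \<theta> \<in> T \<Longrightarrow> 0 \<le> \<theta> \<and> \<theta> < hc_theta_plus \<alpha>"
  shows "continuous_on (T \<times> X) (\<lambda>(\<theta>, p). hc_f \<alpha> \<theta> (cos p))"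
proof -
  have "sqrt (hc_P \<alpha> (fst z) (cos (snd z))) * (\<alpha> + sqrt (hc_P \<alpha> (fst z) (cos (snd z)))) \<noteq> 0"
    if "z \<in> T \<times> X" for z
  proof -
    have "hc_P \<alpha> (fst z) (cos (snd z)) > 0" 
      using hc_P_pos[of \<alpha> "fst z" "cos (snd z)"] assms that by (auto simp: mem_Times_iff)
    then have "sqrt (hc_P \<alpha> (fst z) (cos (snd z))) > 0" by simp
    then show ?thesis using assms by (metis add_pos_pos less_irrefl mult_pos_pos)
  qed
  moreover have C: "continuous_on (T \<times> X) (\<lambda>z. hc_C \<alpha> (fst z))"
    unfolding hc_C_def using assms by (intro continuous_intros) auto
  moreover have "continuous_on (T \<times> X) (\<lambda>z. hc_P \<alpha> (fst z) (cos (snd z)))"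
    unfolding hc_P_def by (intro continuous_intros C)
  ultimately show ?thesis
    unfolding hc_f_def case_prod_beta by (intro continuous_intros) auto
qed

lemma continuous_hc_f_section:
  assumes "\<alpha> > 0" "0 \<le> \<theta>" "\<theta> < hc_theta_plus \<alpha>"
  shows "continuous_on X (\<lambda>p. hc_f \<alpha> \<theta> (cos p))"
proof -
  have "continuous_on ({\<theta>} \<times> X) (\<lambda>(\<theta>, p). hc_f \<alpha> \<theta> (cos p))"
    using assms by (intro continuous_hc_f) auto
  then have "continuous_on X ((\<lambda>(\<theta>, p). hc_f \<alpha> \<theta> (cos p)) \<circ> Pair \<theta>)"
    by (intro continuous_on_compose continuous_intros)
      (auto elim!: continuous_on_subset)
  then show ?thesis by (simp add: o_def)
qed

lemma continuous_hc_L: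
  assumes "\<alpha> > 0" "\<And>\<theta>. \<theta> \<in> T \<Longrightarrow> 0 \<le> \<theta> \<and> \<theta> < hc_theta_plus \<alpha>"
  shows "continuous_on T (hc_L \<alpha>)"
proof -
  have "continuous_on T (\<lambda>\<theta>. integral (cbox 0 pi) (\<lambda>p. hc_f \<alpha> \<theta> (cos p)))"
    using continuous_hc_f[OF assms] by (intro integral_continuous_on_param) auto
  then show ?thesis
    using assms by (auto simp: hc_L_eq cong: continuous_on_cong)
qed

text \<open>Since \<open>w\<^sup>2 - \<alpha>\<^sup>2 = y (c - k y)\<close> for \<open>w = sqrt P\<close> and \<open>y = x\<^sup>2\<close>, the integrand is increasing in \<open>k\<close>
  and decreasing in \<open>w\<close>, hence increasing in \<open>\<theta>\<close>.\<close>
lemma hc_f_alt: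
  fixes \<alpha> c k y w :: real
  assumes "\<alpha> > 0" "w > 0" "y > 0" "w^2 = \<alpha>^2 + c * y - k * y^2"
  shows "(2 * \<alpha> * k * y - \<alpha> * c + k * y * w) / (w * (\<alpha> + w)) = k * y / w + \<alpha> / y * (\<alpha> / w - 1)"
proof -
  have "(2 * \<alpha> * k * y - \<alpha> * c + k * y * w) * y = (k * y * y + \<alpha> * (\<alpha> - w)) * (\<alpha> + w)"
    using assms(4) by (algebra)
  then have "(2 * \<alpha> * k * y - \<alpha> * c + k * y * w) / (w * (\<alpha> + w)) = (k * y * y + \<alpha> * (\<alpha> - w)) / (y * w)"
    using assms(1-3) by (subst frac_eq_eq) (simp_all add: mult_ac add_pos_pos less_imp_neq[symmetric])
  also have "\<dots> = k * y / w + \<alpha> / y * (\<alpha> / w - 1)"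
    using assms(1-3) by (simp add: field_simps)
  finally show ?thesis .
qed

lemma hc_f_strict_mono:
  assumes a: "\<alpha> > 0" "0 \<le> \<theta>1" "\<theta>1 < \<theta>2" "\<theta>2 < hc_theta_plus \<alpha>" "\<theta>2 \<le> pi / 4" "\<bar>x\<bar> \<le> 1"
  shows "hc_f \<alpha> \<theta>1 x < hc_f \<alpha> \<theta>2 x"
proof -
  define c1 where "c1 = cos (2 * \<theta>1)"
  define c2 where "c2 = cos (2 * \<theta>2)"
  define k1 where "k1 = (hc_C \<alpha> \<theta>1)^2"
  define k2 where "k2 = (hc_C \<alpha> \<theta>2)^2"
  define w1 where "w1 = sqrt (hc_P \<alpha> \<theta>1 x)"
  define w2 where "w2 = sqrt (hc_P \<alpha> \<theta>2 x)"
  define y where "y = x^2"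
  have c: "c2 < c1"
    unfolding c1_def c2_def using a by (intro cos_monotone_0_pi) auto
  have c2: "c2 \<ge> 0" unfolding c2_def using a by (intro cos_ge_zero) auto
  \<comment> \<open>Here \<open>\<theta>2 \<le> pi / 4\<close> matters: both cosines are
    nonnegative, so their squares are ordered as well.\<close>
  have k: "k1 \<le> k2"
  proof -
    have "c2^2 \<le> c1^2" using c c2 by (intro power_mono) auto
    then show ?thesis
      using a(1) by (simp add: k1_def k2_def hc_C_sq c1_def c2_def divide_right_mono)
  qed
  have k0: "k1 \<ge> 0" by (simp add: k1_def)
  have P: "hc_P \<alpha> \<theta>1 x > 0" "hc_P \<alpha> \<theta>2 x > 0"
    using a by (auto intro!: hc_P_pos)
  then have w: "w1 > 0" "w2 > 0" by (auto simp: w1_def w2_def)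
  have w_sq: "w1^2 = \<alpha>^2 + c1 * y - k1 * y^2" "w2^2 = \<alpha>^2 + c2 * y - k2 * y^2"
    using P by (auto simp: w1_def w2_def hc_P_def c1_def c2_def k1_def k2_def y_def)
  have y: "y \<ge> 0" by (simp add: y_def)
  have f: "hc_f \<alpha> \<theta>1 x = (2 * \<alpha> * k1 * y - \<alpha> * c1 + k1 * y * w1) / (w1 * (\<alpha> + w1))"
     "hc_f \<alpha> \<theta>2 x = (2 * \<alpha> * k2 * y - \<alpha> * c2 + k2 * y * w2) / (w2 * (\<alpha> + w2))"
    by (auto simp: hc_f_def w1_def w2_def c1_def c2_def k1_def k2_def y_def)
  show ?thesis
  \<comment> \<open>\<open>hc_f_alt\<close> divides by \<open>y\<close>. At \<open>y = 0\<close>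
    both roots equal \<alpha>, and strictness comes from the term \<open>- \<alpha> * c\<close>
    alone.\<close>
  proof (cases "y = 0")
    case True
    then have "w1 = \<alpha>" "w2 = \<alpha>" using w_sq w a(1) by (auto simp: power2_eq_iff)
    then show ?thesis using True c a(1) by (simp add: f divide_strict_right_mono)
  next
    case False
    then have y: "y > 0" using y by simp
    have "w2^2 < w1^2"
    proof -
      have "c2 * y < c1 * y" "k1 * y^2 \<le> k2 * y^2" using y c k by (auto intro: mult_right_mono)
      then show ?thesis unfolding w_sq by linarith
    qed
    then have ww: "w2 < w1" using w by (simp add: power2_less_imp_less)
    have "k1 * y / w1 \<le> k2 * y / w2"
      using ww w y k k0 by (intro frac_le mult_right_mono mult_nonneg_nonneg) auto
    moreover have "\<alpha> / w1 < \<alpha> / w2"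
      using a w ww by (intro divide_strict_left_mono mult_pos_pos) auto
    then have "\<alpha> / y * (\<alpha> / w1 - 1) < \<alpha> / y * (\<alpha> / w2 - 1)"
      using y a by (intro mult_strict_left_mono) auto
    ultimately show ?thesis
      unfolding f hc_f_alt[OF a(1) w(1) y w_sq(1)] hc_f_alt[OF a(1) w(2) y w_sq(2)] by linarith
  qed
qed

section \<open>Monotonicity, sign change and the unique root of \<open>L\<close>\<close>

lemma hc_L_strict_mono:
  assumes a: "\<alpha> > 0" "0 \<le> \<theta>1" "\<theta>1 < \<theta>2" "\<theta>2 < hc_theta_plus \<alpha>" "\<theta>2 \<le> pi / 4"
  shows "hc_L \<alpha> \<theta>1 < hc_L \<alpha> \<theta>2"
proof -
  have "integral {0..pi} (\<lambda>p. hc_f \<alpha> \<theta>1 (cos p)) < integral {0..pi} (\<lambda>p. hc_f \<alpha> \<theta>2 (cos p))"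
    using a by (intro integral_less_real continuous_hc_f_section hc_f_strict_mono) auto
  then show ?thesis using a by (simp add: hc_L_eq)
qed

lemma hc_theta_plus_pos: "\<alpha> > 0 \<Longrightarrow> hc_theta_plus \<alpha> > 0"
proof (cases "\<alpha> > 1")
  case False
  assume a: "\<alpha> > 0"
  have "\<alpha>^2 \<le> 1" using a False by (simp add: abs_square_le_1)
  then have "arccos 1 < arccos (1 - 2 * \<alpha>^2)"
    using a by (intro arccos_less_arccos) auto
  then show ?thesis using False by (simp add: hc_theta_plus_def)
qed (simp add: hc_theta_plus_def)

text \<open>At \<theta> = 0 the constant \<open>C\<close> vanishes and
  \<open>w \<ge> \<alpha>\<close>. By monotonicity in \<theta>, the lower bound
  \<open>- 1 / (2 * \<alpha>)\<close> carries over to the positive angles up to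
  \<open>pi / 4\<close> and controls the part of the integral where no better estimate is at
  hand.\<close>

lemma hc_f_0:
  assumes "\<alpha> > 0"
  shows "hc_f \<alpha> 0 x < 0" "- 1 / (2 * \<alpha>) \<le> hc_f \<alpha> 0 x"
proof -
  define w where "w = sqrt (hc_P \<alpha> 0 x)"
  have "hc_P \<alpha> 0 x \<ge> \<alpha>^2" by (simp add: hc_P_def hc_C_def)
  then have "w \<ge> sqrt (\<alpha>^2)" unfolding w_def by (rule real_sqrt_le_mono)
  then have w: "w \<ge> \<alpha>" using assms by simp
  have eq: "hc_f \<alpha> 0 x = - \<alpha> / (w * (\<alpha> + w))"
    by (simp add: hc_f_def hc_C_def w_def)
  show "hc_f \<alpha> 0 x < 0" using eq w assms by simp
  have "\<alpha> / (w * (\<alpha> + w)) \<le> \<alpha> / (\<alpha> * (\<alpha> + \<alpha>))"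
    using w assms by (intro divide_left_mono mult_mono mult_pos_pos) auto
  then show "- 1 / (2 * \<alpha>) \<le> hc_f \<alpha> 0 x" using eq assms by simp
qed

lemma hc_L_0: "\<alpha> > 0 \<Longrightarrow> hc_L \<alpha> 0 < 0"
proof -
  assume a: "\<alpha> > 0"
  have "integral {0..pi} (\<lambda>p. hc_f \<alpha> 0 (cos p)) < integral {0..pi} (\<lambda>p. 0::real)"
    using a hc_theta_plus_pos[of \<alpha>] hc_f_0 pi_gt_zero
    by (intro integral_less_real continuous_hc_f_section) (auto simp del: pi_gt_zero)
  then show ?thesis using a hc_theta_plus_pos[of \<alpha>] by (simp add: hc_L_eq)
qed

text \<open>At \<open>pi / 4\<close> the cosine of the double angle is 0, so the only negative term
  of the numerator disappears. The integrand is nonnegative, and it is positive at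
  \<open>x = 1\<close>.\<close>

lemma hc_L_pi4:
  assumes "\<alpha> > 0" "pi / 4 < hc_theta_plus \<alpha>"
  shows "hc_L \<alpha> (pi/4) > 0"
proof -
  have "integral {0..pi} (\<lambda>p. 0::real) < integral {0..pi} (\<lambda>p. hc_f \<alpha> (pi/4) (cos p))"
  proof -
    have le: "hc_f \<alpha> (pi/4) x \<ge> 0" if "\<bar>x\<bar> \<le> 1" for x
      using hc_P_pos[of \<alpha> "pi/4" x] that assms
      by (auto simp: hc_f_def intro!: divide_nonneg_nonneg)
    have pos: "hc_f \<alpha> (pi/4) 1 > 0"
    proof -
      have "sqrt (hc_P \<alpha> (pi/4) 1) > 0" using hc_P_pos[of \<alpha> "pi/4" 1] assms by simp
      then show ?thesis using assms(1)
        by (auto simp: hc_f_def hc_C_def intro!: divide_pos_pos mult_pos_pos add_pos_pos)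
    qed
    have cont: "continuous_on {0..pi} (\<lambda>p. hc_f \<alpha> (pi/4) (cos p))"
      using assms by (intro continuous_hc_f_section) auto
    have "integral {0..pi} (\<lambda>p. hc_f \<alpha> (pi/4) (cos p)) \<noteq> 0"
    proof
      assume "integral {0..pi} (\<lambda>p. hc_f \<alpha> (pi/4) (cos p)) = 0"
      then have "\<forall>p\<in>{0..pi}. hc_f \<alpha> (pi/4) (cos p) = 0"
        using integral_eq_0_iff[OF cont] le by auto
      from bspec[OF this, of 0] show False using pos by simp
    qed
    moreover have "integral {0..pi} (\<lambda>p. hc_f \<alpha> (pi/4) (cos p)) \<ge> 0"
      using cont le by (intro integral_nonneg integrable_continuous_interval) auto
    ultimately show ?thesis by simp
  qed
  then show ?thesis using assms by (simp add: hc_L_eq)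
qed

text \<open>For \<open>2 \<alpha>\<^sup>2 \<le> 1\<close> the integrand degenerates at \<open>\<theta> = \<theta>\<^sup>+\<close>: there \<open>P\<close> vanishes at \<open>x = 1\<close>, and the
  integral diverges logarithmically. If \<open>cos (2 \<theta>)\<close> exceeds its limit \<open>1 - 2 \<alpha>\<^sup>2\<close> by \<open>\<eta>\<^sup>2\<close>, then the
  integrand is at least a constant over \<open>p\<close> on \<open>[\<eta>, \<alpha> / 2]\<close>.\<close>
lemma hc_f_lower:
  assumes a: "\<alpha> > 0" "2 * \<alpha>^2 \<le> 1"
    and \<eta>: "0 < \<eta>" "\<eta> \<le> 1" "8 * \<eta>^2 \<le> \<alpha>^2" and c: "cos (2 * \<theta>) = 1 - 2 * \<alpha>^2 + \<eta>^2"
    and p: "\<eta> \<le> p" "p \<le> \<alpha> / 2"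
  shows "\<alpha>^2 / (3 * (\<alpha> + 2)) / p \<le> hc_f \<alpha> \<theta> (cos p)"
proof -
  define k where "k = (hc_C \<alpha> \<theta>)^2"
  define c where "c = cos (2 * \<theta>)"
  define \<sigma> where "\<sigma> = (sin p)^2"
  define w where "w = sqrt (hc_P \<alpha> \<theta> (cos p))"
  have c': "c = 1 - 2 * \<alpha>^2 + \<eta>^2" "0 \<le> c" "c \<le> 1"
    using assms zero_le_power2[of \<eta>] zero_le_power2[of \<alpha>] cos_le_one[of "2*\<theta>"]
    unfolding c_def by linarith+
  have k: "4 * \<alpha>^2 * k = 1 - c^2" "0 \<le> k"
    unfolding k_def c_def by (use a hc_C_sq[of \<alpha> \<theta>] in simp) (rule zero_le_power2)
  have k_le: "k \<le> 1 / (4 * \<alpha>^2)"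
    using a by (simp add: k_def hc_C_sq divide_right_mono)
  have "0 < p" "p < 1"
  proof -
    have "\<alpha>^2 < 1^2" using a by simp
    then have "\<alpha> < 1" using a by (simp add: power2_less_imp_less)
    then show "0 < p" "p < 1" using p \<eta> by auto
  qed
  have "0 < sin p"
    using \<open>0 < p\<close> \<open>p < 1\<close> pi_gt3 by (intro sin_gt_zero) auto
  then have "\<sigma> \<le> p^2" "0 \<le> \<sigma>"
    unfolding \<sigma>_def using sin_x_le_x[of p] \<open>0 < p\<close> by (auto intro!: power_mono)
  have "p^2 \<le> (\<alpha>/2)^2" using p \<open>0 < p\<close> by (intro power_mono) auto
  then have \<sigma>4: "\<sigma> \<le> \<alpha>^2 / 4" using \<open>\<sigma> \<le> p^2\<close> by (simp add: power_divide)
  have "\<eta>^2 \<le> p^2" using p \<eta> by (intro power_mono) auto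
  have y: "(cos p)^2 = 1 - \<sigma>" by (simp add: \<sigma>_def cos_squared_eq)
  have P: "hc_P \<alpha> \<theta> (cos p) = \<alpha>^2 + c * (1 - \<sigma>) - k * (1 - \<sigma>)^2"
  proof -
    have "(cos p)^4 = ((cos p)^2)^2" by simp
    then show ?thesis unfolding hc_P_def c_def k_def y by simp
  qed
  \<comment> \<open>In the limit \<open>\<eta> = 0\<close>, \<open>\<sigma> = 0\<close> one has
    \<open>2 * k = 1 + c\<close>, so the value is 1. The perturbations by \<open>\<eta>\<close> and
    by \<open>\<sigma>\<close> cost at most 1/8 each.\<close>
  have num: "3/4 \<le> 2 * k * (1 - \<sigma>) - c"
  proof -
    have "2 * k - c = 1 - \<eta>^2 / (2 * \<alpha>^2) * (1 + c)"
    proof -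
      have "2 * \<alpha>^2 * (2 * k - c) = 2 * \<alpha>^2 - \<eta>^2 * (1 + c)"
        using k(1) c'(1) by algebra
      then show ?thesis using a by (simp add: field_simps)
    qed
    moreover have "\<eta>^2 / (2 * \<alpha>^2) * (1 + c) \<le> (1 / 16) * 2"
      using a \<eta> c'(2,3) by (intro mult_mono) (auto simp: divide_simps)
    moreover have "2 * k * \<sigma> \<le> 2 * (1 / (4 * \<alpha>^2)) * (\<alpha>^2 / 4)"
      using k_le k \<sigma>4 \<open>0 \<le> \<sigma>\<close> a by (intro mult_mono) auto
    moreover have "2 * (1 / (4 * \<alpha>^2)) * (\<alpha>^2 / 4) = 1 / 8" using a by simp
    moreover have "2 * k * (1 - \<sigma>) - c = (2 * k - c) - 2 * k * \<sigma>" by algebra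
    ultimately show ?thesis by linarith
  qed
  have c_gt: "1 - 2 * \<alpha>^2 < c" using c'(1) \<eta>(1) by simp
  have P_pos: "0 < hc_P \<alpha> \<theta> (cos p)"
  proof -
    have "hc_P \<alpha> \<theta> (cos p) = \<alpha>\<^sup>2 + c * (cos p)^2 - (1 - c\<^sup>2) / (4 * \<alpha>\<^sup>2) * ((cos p)^2)\<^sup>2"
      using a by (simp add: hc_P_def c_def hc_C_sq)
    also have "\<dots> > 0"
      using a(1) c'(2,3) c_gt by (intro hc_P_pos_aux) (auto simp: abs_square_le_1)
    finally show ?thesis .
  qed
  then have "0 < w" by (simp add: w_def)
  \<comment> \<open>The vanishing of \<open>P\<close> at the limit is quantified by
    \<open>4 * \<alpha>^2 * P \<le> 5 * p^2\<close>: 3 from the \<open>\<eta>\<close> terms, since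
    \<open>\<eta> \<le> p\<close>, and 2 from the \<open>\<sigma>\<close> terms. The number 9/8 is a
    rational upper bound for half the square root of 5.\<close>
  have "hc_P \<alpha> \<theta> (cos p) \<le> (9/8 * p / \<alpha>)^2"
  proof -
    have e: "4 * \<alpha>^2 * (\<alpha>^2 + c * (1 - \<sigma>) - k * (1 - \<sigma>)^2)
      = \<eta>^2 * (2 + \<eta>^2) + (2 * (1 - c^2) - 4 * \<alpha>^2 * c) * \<sigma> - (1 - c^2) * \<sigma>^2"
      using k(1) c'(1) by algebra
    have "\<eta>^2 * (2 + \<eta>^2) \<le> p^2 * (2 + 1)"
      using \<open>\<eta>^2 \<le> p^2\<close> \<eta> by (intro mult_mono) (auto simp: abs_square_le_1)
    moreover have "(2 * (1 - c^2) - 4 * \<alpha>^2 * c) * \<sigma> \<le> 2 * p^2"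
    proof (rule mult_mono)
      have "0 \<le> 4 * \<alpha>^2 * c" using c'(2) by (intro mult_nonneg_nonneg) auto
      moreover have "2 * (1 - c^2) \<le> 2" by simp
      ultimately show "2 * (1 - c^2) - 4 * \<alpha>^2 * c \<le> 2" by (metis diff_mono diff_zero)
    qed (use \<open>\<sigma> \<le> p^2\<close> \<open>0 \<le> \<sigma>\<close> in auto)
    moreover have "(1 - c^2) * \<sigma>^2 \<ge> 0" using c'(2,3) by (intro mult_nonneg_nonneg) (auto simp: abs_square_le_1)
    moreover have "A + B - D \<le> 5 * q" if "A \<le> q * (2 + 1)" "B \<le> 2 * q" "0 \<le> D" for A B D q :: real
      using that by simp
    ultimately have "4 * \<alpha>^2 * hc_P \<alpha> \<theta> (cos p) \<le> 5 * p^2"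
      unfolding P e by blast
    also have "\<dots> \<le> 4 * \<alpha>^2 * (9/8 * p / \<alpha>)^2" using a by (simp add: power_divide power_mult_distrib)
    finally show ?thesis using a by simp
  qed
  then have "w \<le> sqrt ((9/8 * p / \<alpha>)^2)" unfolding w_def by (rule real_sqrt_le_mono)
  then have w: "w \<le> 9/8 * p / \<alpha>" using a \<open>0 < p\<close> by simp
  have "9/8 * p / \<alpha> \<le> 2" using p a by (simp add: field_simps)
  \<comment> \<open>The estimate yields twice the constant that is claimed; the factor is given
    away.\<close>
  have "\<alpha>^2 / (3 * (\<alpha> + 2)) / p \<le> \<alpha> * (3/4) / ((9/8 * p / \<alpha>) * (\<alpha> + 2))"
  proof -
    have "\<alpha> * (3/4) / ((9/8 * p / \<alpha>) * (\<alpha> + 2)) = 2 * (\<alpha>^2 / (3 * (\<alpha> + 2)) / p)"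
      using a(1) \<open>0 < p\<close> by (simp add: divide_simps power2_eq_square)
    moreover have "0 \<le> \<alpha>^2 / (3 * (\<alpha> + 2)) / p" using a(1) \<open>0 < p\<close> by simp
    ultimately show ?thesis by linarith
  qed
  also have "\<dots> \<le> (2 * \<alpha> * k * (1 - \<sigma>) - \<alpha> * c + k * (1 - \<sigma>) * w) / (w * (\<alpha> + w))"
  proof (rule frac_le)
    have "\<alpha> * (3/4) \<le> \<alpha> * (2 * k * (1 - \<sigma>) - c)" using num a by (intro mult_left_mono) auto
    moreover have "0 \<le> k * (1 - \<sigma>) * w"
      unfolding y[symmetric] using k \<open>0 < w\<close> by (intro mult_nonneg_nonneg) auto
    ultimately show "\<alpha> * (3/4) \<le> 2 * \<alpha> * k * (1 - \<sigma>) - \<alpha> * c + k * (1 - \<sigma>) * w"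
      by (simp add: algebra_simps)
    then show "0 \<le> 2 * \<alpha> * k * (1 - \<sigma>) - \<alpha> * c + k * (1 - \<sigma>) * w" using a by simp
    show "w * (\<alpha> + w) \<le> 9/8 * p / \<alpha> * (\<alpha> + 2)"
      using w \<open>0 < w\<close> \<open>9/8 * p / \<alpha> \<le> 2\<close> a by (intro mult_mono) auto
    show "0 < w * (\<alpha> + w)" using \<open>0 < w\<close> a by simp
  qed
  also have "\<dots> = hc_f \<alpha> \<theta> (cos p)" by (simp add: hc_f_def y w_def k_def c_def)
  finally show ?thesis .
qed

text \<open>On [\<open>\<eta>\<close>, \<open>s\<close>] the integrand is at least
  \<open>\<kappa> / p\<close>, which integrates to \<open>\<kappa> * ln (s / \<eta>)\<close>. Adding
  \<open>1 / (2 * \<alpha>)\<close> makes the integrand nonnegative on all of [0, pi], so the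
  interval may be enlarged at the price of \<open>pi / (2 * \<alpha>)\<close>, which a small
  \<open>\<eta>\<close> outweighs.\<close>

lemma hc_L_pos_exists:
  assumes a: "\<alpha> > 0" "2 * \<alpha>^2 \<le> 1"
  obtains \<theta> where "0 < \<theta>" "\<theta> < hc_theta_plus \<alpha>" "\<theta> < pi / 4" "hc_L \<alpha> \<theta> > 0"
proof -
  define \<kappa> where "\<kappa> = \<alpha>^2 / (3 * (\<alpha> + 2))"
  define s where "s = \<alpha> / 2"
  \<comment> \<open>The second entry makes \<open>\<kappa> * ln (s / \<eta>)\<close> at least
    \<open>pi / (2 * \<alpha>) + 1\<close>. The first gives \<open>\<eta> < s\<close>, the bound on
    \<open>8 * \<eta>^2\<close>, and a cosine strictly between \<open>1 - 2 * \<alpha>^2\<close> and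
    1.\<close>
  define \<eta> where "\<eta> = min (\<alpha> / 3) (s * exp (- ((pi / (2 * \<alpha>) + 1) / \<kappa>)))"
  define \<theta> where "\<theta> = arccos (1 - 2 * \<alpha>^2 + \<eta>^2) / 2"
  have \<kappa>: "\<kappa> > 0" using a by (simp add: \<kappa>_def)
  have s: "s > 0" using a by (simp add: s_def)
  have "\<alpha>^2 < 1^2" using a by simp
  then have a1: "\<alpha> < 1" using a by (simp add: power2_less_imp_less)
  have \<eta>: "\<eta> > 0" "\<eta> \<le> \<alpha> / 3" using s a by (auto simp: \<eta>_def)
  have "\<eta>^2 \<le> (\<alpha> / 3)^2" using \<eta> by (intro power_mono) auto
  then have \<eta>2: "9 * \<eta>^2 \<le> \<alpha>^2" by (simp add: power_divide)
  have \<eta>0: "\<eta>^2 > 0" using \<eta> by simp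
  have \<eta>8: "8 * \<eta>^2 \<le> \<alpha>^2" using \<eta>2 \<eta>0 by linarith
  have \<eta>s: "\<eta> < s" using \<eta> a by (simp add: s_def)
  have c_bounds: "0 < 1 - 2 * \<alpha>^2 + \<eta>^2" "1 - 2 * \<alpha>^2 + \<eta>^2 < 1" "1 - 2 * \<alpha>^2 < 1 - 2 * \<alpha>^2 + \<eta>^2"
    using a(2) \<eta>2 \<eta>0 by linarith+
  have cos\<theta>: "cos (2 * \<theta>) = 1 - 2 * \<alpha>^2 + \<eta>^2"
    using c_bounds by (simp add: \<theta>_def cos_arccos)
  have "arccos 1 < arccos (1 - 2 * \<alpha>^2 + \<eta>^2)" using c_bounds by (intro arccos_less_arccos) auto
  then have \<theta>0: "0 < \<theta>" by (simp add: \<theta>_def)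
  have "arccos (1 - 2 * \<alpha>^2 + \<eta>^2) < arccos (1 - 2 * \<alpha>^2)"
    using c_bounds a by (intro arccos_less_arccos) auto
  then have \<theta>1: "\<theta> < hc_theta_plus \<alpha>" using a1 by (simp add: \<theta>_def hc_theta_plus_def)
  have "arccos (1 - 2 * \<alpha>^2 + \<eta>^2) < arccos 0"
    using c_bounds by (intro arccos_less_arccos) auto
  then have \<theta>2: "\<theta> < pi / 4" by (simp add: \<theta>_def)
  let ?f = "\<lambda>p. hc_f \<alpha> \<theta> (cos p)"
  \<comment> \<open>Comparison with \<theta> = 0.\<close>
  have nn: "0 \<le> ?f p + 1 / (2 * \<alpha>)" for p
    using hc_f_strict_mono[OF a(1) order_refl \<theta>0 \<theta>1, of "cos p"] \<theta>2 hc_f_0(2)[OF a(1), of "cos p"]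
    by simp
  have cont: "continuous_on X ?f" for X
    using a \<theta>0 \<theta>1 by (intro continuous_hc_f_section) auto
  have log: "((\<lambda>p. \<kappa> / p) has_integral (\<kappa> * ln s - \<kappa> * ln \<eta>)) {\<eta>..s}"
    using \<eta>s \<eta>
    by (intro fundamental_theorem_of_calculus)
      (auto simp flip: has_real_derivative_iff_has_vector_derivative
        intro!: derivative_eq_intros)
  have "\<eta> \<le> s * exp (- ((pi / (2 * \<alpha>) + 1) / \<kappa>))" by (simp add: \<eta>_def)
  then have "ln \<eta> \<le> ln (s * exp (- ((pi / (2 * \<alpha>) + 1) / \<kappa>)))" using \<eta> s by (subst ln_le_cancel_iff) auto
  then have "ln \<eta> \<le> ln s - (pi / (2 * \<alpha>) + 1) / \<kappa>" using s by (simp only: ln_mult_pos exp_gt_zero ln_exp)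
  then have "\<kappa> * ln \<eta> \<le> \<kappa> * (ln s - (pi / (2 * \<alpha>) + 1) / \<kappa>)" using \<kappa> by (intro mult_left_mono) auto
  then have "pi / (2 * \<alpha>) + 1 \<le> \<kappa> * ln s - \<kappa> * ln \<eta>" using \<kappa> by (simp add: right_diff_distrib)
  also have "\<dots> = integral {\<eta>..s} (\<lambda>p. \<kappa> / p)" using log by (simp add: integral_unique)
  also have "\<dots> \<le> integral {\<eta>..s} (\<lambda>p. ?f p + 1 / (2 * \<alpha>))"
  proof (rule integral_le)
    show "(\<lambda>p. \<kappa> / p) integrable_on {\<eta>..s}" using log by blast
    show "(\<lambda>p. ?f p + 1 / (2 * \<alpha>)) integrable_on {\<eta>..s}"
      by (intro integrable_continuous_interval continuous_intros cont)
    show "\<kappa> / p \<le> ?f p + 1 / (2 * \<alpha>)" if "p \<in> {\<eta>..s}" for p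
    proof -
      have "\<kappa> / p \<le> ?f p"
        unfolding \<kappa>_def using that a \<eta> \<eta>8 a1 cos\<theta>
        by (intro hc_f_lower[where \<eta> = \<eta>]) (simp_all add: s_def)
      then show ?thesis using a(1) by (smt (verit) divide_pos_pos)
    qed
  qed
  also have "\<dots> \<le> integral {0..pi} (\<lambda>p. ?f p + 1 / (2 * \<alpha>))"
  proof (rule integral_subset_le)
    show "{\<eta>..s} \<subseteq> {0..pi}" using \<eta> a1 pi_gt3 by (auto simp: s_def)
    show "\<forall>p\<in>{0..pi}. 0 \<le> ?f p + 1 / (2 * \<alpha>)" using nn by blast
  qed (rule integrable_continuous_interval, intro continuous_intros cont)+
  also have "\<dots> = hc_L \<alpha> \<theta> + pi / (2 * \<alpha>)"
    using hc_L_eq[OF a(1) _ \<theta>1] \<theta>0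
    by (subst integral_add) (auto intro!: integrable_continuous_interval cont)
  finally have "hc_L \<alpha> \<theta> > 0" by simp
  then show ?thesis using that \<theta>0 \<theta>1 \<theta>2 by blast
qed

text \<open>Existence is the intermediate value theorem between 0 and an angle with
  \<open>L > 0\<close>; uniqueness is strict monotonicity. If \<open>2 * \<alpha>^2 > 1\<close>,
  then \<open>pi / 4\<close> lies below \<theta>-plus and is such an angle.\<close>

lemma hc_theta_spec:
  assumes a: "\<alpha> > 0"
  shows "0 < hc_theta \<alpha>" "hc_theta \<alpha> < hc_theta_plus \<alpha>" "hc_theta \<alpha> < pi / 4" 
    "hc_L \<alpha> (hc_theta \<alpha>) = 0"
proof -
  let ?Q = "\<lambda>\<theta>. 0 < \<theta> \<and> \<theta> < hc_theta_plus \<alpha> \<and> \<theta> < pi / 4 \<and> hc_L \<alpha> \<theta> = 0"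
  obtain \<theta>1 where t: "0 < \<theta>1" "\<theta>1 < hc_theta_plus \<alpha>" "\<theta>1 \<le> pi / 4" "hc_L \<alpha> \<theta>1 > 0"
  proof (cases "2 * \<alpha>^2 \<le> 1")
    case True
    then show ?thesis using hc_L_pos_exists[OF a True] that by (metis less_imp_le)
  next
    case False
    have "pi / 4 < hc_theta_plus \<alpha>"
    proof (cases "\<alpha> > 1")
      case False
      have "\<alpha>^2 \<le> 1" using a False by (simp add: abs_square_le_1)
      then have "arccos 0 < arccos (1 - 2 * \<alpha>^2)"
        using \<open>\<not> 2 * \<alpha>^2 \<le> 1\<close> by (intro arccos_less_arccos) auto
      then show ?thesis using False by (simp add: hc_theta_plus_def)
    qed (simp add: hc_theta_plus_def)
    then show ?thesis using that[of "pi/4"] hc_L_pi4[OF a] by simp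
  qed
  have "continuous_on {0..\<theta>1} (hc_L \<alpha>)" using t a by (intro continuous_hc_L) auto
  then obtain \<theta> where \<theta>: "0 \<le> \<theta>" "\<theta> \<le> \<theta>1" "hc_L \<alpha> \<theta> = 0"
    using IVT'[of "hc_L \<alpha>" 0 0 \<theta>1] hc_L_0[OF a] t by auto
  have "\<theta> \<noteq> 0" "\<theta> \<noteq> \<theta>1" using \<theta> t hc_L_0[OF a] by auto
  then have ex: "?Q \<theta>" using \<theta> t by auto
  moreover have "\<theta>' = \<theta>" if "?Q \<theta>'" for \<theta>'
    using hc_L_strict_mono[OF a, of \<theta> \<theta>'] hc_L_strict_mono[OF a, of \<theta>' \<theta>] ex that
    by (cases \<theta> \<theta>' rule: linorder_cases) auto
  ultimately have "?Q (THE \<theta>. ?Q \<theta>)" by (rule theI)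
  then show "0 < hc_theta \<alpha>" "hc_theta \<alpha> < hc_theta_plus \<alpha>" "hc_theta \<alpha> < pi / 4" 
    "hc_L \<alpha> (hc_theta \<alpha>) = 0"
    by (auto simp: hc_theta_def)
qed

subsection \<open>The profile functions\<close>

text \<open>A Darboux argument, which does without continuity of \<open>f'\<close>; this matters
  because \<open>\<phi>'\<close> is known only through its square. The mean value theorem makes
  \<open>f\<close> injective, hence strictly monotone, and derivatives of opposite signs at two
  points contradict either direction.\<close>

lemma DERIV_nonzero_same_sign:
  fixes f :: "real \<Rightarrow> real"
  assumes f: "\<And>u. (f has_real_derivative f' u) (at u)" and nz: "\<And>u. f' u \<noteq> 0" and "f' a < 0"
  shows "f' u < 0"
proof (rule ccontr)
  assume "\<not> f' u < 0"
  then have u: "f' u > 0" using nz[of u] by simp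
  have cont: "continuous_on UNIV f"
    using f by (meson DERIV_continuous_on has_field_derivative_at_within)
  have "inj f"
  proof (rule linorder_injI)
    fix x y :: real assume "x < y"
    then obtain z where "f y - f x = (y - x) * f' z"
      using MVT2[OF \<open>x < y\<close> f] by blast
    then show "f x \<noteq> f y" using nz[of z] \<open>x < y\<close> by auto
  qed
  then have "strict_mono f \<or> strict_antimono_on UNIV f"
    using injective_eq_monotone_map[OF is_interval_univ cont] by simp
  then show False
  proof
    assume m: "strict_mono f"
    obtain d where "d > 0" "\<And>h. h > 0 \<Longrightarrow> h < d \<Longrightarrow> f (a + h) < f a"
      using DERIV_neg_dec_right[OF f \<open>f' a < 0\<close>] by blast
    from this(2)[of "d/2"] \<open>d > 0\<close> show False using strict_monoD[OF m, of a "a + d/2"] by simp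
  next
    assume m: "strict_antimono_on UNIV f"
    obtain d where "d > 0" "\<And>h. h > 0 \<Longrightarrow> h < d \<Longrightarrow> f u < f (u + h)"
      using DERIV_pos_inc_right[OF f u] by blast
    from this(2)[of "d/2"] \<open>d > 0\<close> show False using monotone_onD[OF m, of u "u + d/2"] by simp
  qed
qed

text \<open>\<open>T p\<close> is the time in which a solution of \<open>\<phi>' = w \<phi>\<close>
  runs from 0 to \<open>p\<close>. Evenness of \<open>w\<close> makes \<open>T\<close> odd, and
  periodicity makes it additive under shifts by \<open>pi\<close>; so it is unbounded in both
  directions and therefore onto.\<close>

lemma time_function_exists:
  fixes w :: "real \<Rightarrow> real"
  assumes w: "continuous_on UNIV w" "\<And>p. w p > 0"
    and per: "\<And>p. w (p + pi) = w p" and even: "\<And>p. w (- p) = w p"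
  obtains T where "T 0 = 0" "\<And>p. (T has_real_derivative 1 / w p) (at p)" "strict_mono T" "surj T"
    "\<And>p. T (p + pi) = T p + T pi" "\<And>p. T (- p) = - T p"
proof -
  have isC: "isCont (\<lambda>p. 1 / w p) p" for p
    using w(1) less_imp_neq[OF w(2), of p]
    by (intro continuous_intros) (auto simp: continuous_on_eq_continuous_at)
  obtain T where T: "T 0 = 0" "\<And>p. (T has_real_derivative 1 / w p) (at p)"
    by (rule real_antiderivative[OF isC]) (rule that)
  have mono: "strict_mono T"
  proof (rule strict_monoI)
    fix x y :: real assume "x < y"
    then show "T x < T y"
    proof (rule DERIV_pos_imp_increasing)
      fix z show "\<exists>d. (T has_real_derivative d) (at z) \<and> 0 < d"
        using T(2)[of z] w(2)[of z] by (intro exI[of _ "1 / w z"]) auto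
    qed
  qed
  have shift: "T (p + pi) = T p + T pi" for p
  proof -
    have "((\<lambda>p. T (p + pi)) has_real_derivative 1 / w p) (at p)" for p
      using T(2)[of "p + pi"] per by (simp add: DERIV_shift)
    from DERIV_eq_imp_diff_const[OF this T(2), of p 0] show ?thesis by (simp add: T(1))
  qed
  have odd: "T (- p) = - T p" for p
  proof -
    have "((\<lambda>p. - T (- p)) has_real_derivative 1 / w p) (at p)" for p
    proof -
      have "((\<lambda>p. T (- p)) has_real_derivative - (1 / w p)) (at p)"
        using T(2)[of "-p"] even[of p] by (simp add: DERIV_mirror)
      from DERIV_minus[OF this] show ?thesis by simp
    qed
    from DERIV_eq_imp_diff_const[OF this T(2), of p 0] show ?thesis by (simp add: T(1))
  qed
  have "T pi > 0" using strict_monoD[OF mono, of 0 pi] T(1) by simp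
  have nat: "T (of_nat n * pi) = of_nat n * T pi" for n
  proof (induction n)
    case (Suc n)
    have "T (of_nat n * pi + pi) = of_nat n * T pi + T pi" using shift Suc by simp
    then show ?case by (simp add: algebra_simps)
  qed (simp add: T(1))
  have cont: "continuous_on A T" for A
    using T(2) by (meson DERIV_continuous_on has_field_derivative_at_within)
  have "\<exists>p. y = T p" for y
  proof -
    obtain n :: nat where n: "\<bar>y\<bar> / T pi \<le> of_nat n" using real_arch_simple by blast
    then have "\<bar>y\<bar> \<le> T (of_nat n * pi)" using \<open>T pi > 0\<close> unfolding nat by (simp add: field_simps)
    then have "T (- (of_nat n * pi)) \<le> y" "y \<le> T (of_nat n * pi)" by (auto simp: odd)
    then obtain p where "T p = y"
      using IVT'[of T "- (of_nat n * pi)" y "of_nat n * pi"] cont by auto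
    then show ?thesis by blast
  qed
  then have "surj T" unfolding surj_def by blast
  show ?thesis by (rule that[OF T mono \<open>surj T\<close> shift odd])
qed

lemma hc_C_pos: "\<alpha> > 0 \<Longrightarrow> 0 < \<theta> \<Longrightarrow> \<theta> < pi / 4 \<Longrightarrow> hc_C \<alpha> \<theta> > 0"
  unfolding hc_C_def by (intro divide_pos_pos sin_gt_zero) auto

text \<open>Separation of variables: the witness is the inverse of the time function at
  \<open>- u\<close>, and the sign selects the decreasing solution.\<close>

lemma hc_phi_exists:
  assumes w: "\<And>p. hc_P \<alpha> \<theta> (cos p) > 0"
  shows "\<exists>\<phi>. \<phi> 0 = 0 \<and> (\<forall>u. \<phi> differentiable (at u)) \<and>
      (\<forall>u. (deriv \<phi> u)^2 = hc_P \<alpha> \<theta> (cos (\<phi> u))) \<and> deriv \<phi> 0 \<le> (0::real)"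
proof -
  define w where "w p = sqrt (hc_P \<alpha> \<theta> (cos p))" for p
  have wpos: "w p > 0" for p using w by (simp add: w_def)
  have cont: "continuous_on UNIV w" unfolding w_def hc_P_def by (intro continuous_intros)
  have per: "w (p + pi) = w p" "w (- p) = w p" for p by (simp_all add: w_def hc_P_def)
  obtain T where T: "T 0 = 0" "\<And>p. (T has_real_derivative 1 / w p) (at p)" "strict_mono T" "surj T"
    by (rule time_function_exists[OF cont wpos per]) (rule that)
  have inj: "inj T" using T(3) by (rule strict_mono_imp_inj_on)
  define \<phi> where "\<phi> u = inv T (- u)" for u
  have T\<phi>: "T (\<phi> u) = - u" for u using T(4) by (simp add: \<phi>_def surj_f_inv_f)
  have \<phi>T: "\<phi> (- T p) = p" for p using inj by (simp add: \<phi>_def)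
  have d: "(\<phi> has_real_derivative - w (\<phi> u)) (at u)" for u
  proof -
    have "isCont (inv T) (T (\<phi> u))"
      by (rule isCont_inverse_function[where d = 1])
        (use inj T(2) in \<open>auto intro: DERIV_isCont\<close>)
    then have "(inv T has_real_derivative inverse (1 / w (\<phi> u))) (at (- u))"
      using T\<phi>[of u] wpos[of "\<phi> u"] T(2)[of "\<phi> u"] surj_f_inv_f[OF T(4)]
      by (intro DERIV_inverse_function[where f = T and a = "- u - 1" and b = "- u + 1"]) (auto simp: \<phi>_def)
    then show ?thesis unfolding \<phi>_def using DERIV_mirror[of "inv T" _ u] by simp
  qed
  then have "deriv \<phi> u = - w (\<phi> u)" for u by (rule DERIV_imp_deriv)
  moreover have "\<phi> 0 = 0" using \<phi>T[of 0] T(1) by simp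
  ultimately show ?thesis
    using d wpos[of "\<phi> 0"] less_imp_le[OF w]
    by (intro exI[of _ \<phi>]) (auto simp: w_def real_differentiable_def)
qed

text \<open>Everything the geometry needs to know about the profile functions. The relation
  \<open>T (\<phi> u) = - u\<close> holds for any function with the defining property of
  \<open>\<phi>\<close>, so it does not matter which one \<open>SOME\<close> picks.\<close>

lemma hc_profile_functions:
  assumes a: "\<alpha> > 0"
  defines "C \<equiv> hc_CC \<alpha>" and "\<phi> \<equiv> hc_phi \<alpha>" and "g \<equiv> hc_Gp \<alpha>" and "\<beta> \<equiv> hc_beta \<alpha>" and "G \<equiv> hc_G \<alpha>"
  obtains h b where "C > 0" "h > 0"
    "\<And>u. (\<phi> has_real_derivative (cos (\<phi> u))^2 * g u - \<alpha>) (at u)"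
    "\<And>u. (cos (\<phi> u))^2 * g u < \<alpha>"
    "\<And>u. (g has_real_derivative ((g u)^2 + C^2) * sin (\<phi> u) * cos (\<phi> u)) (at u)"
    "\<And>u. (\<beta> has_real_derivative C * (cos (\<phi> u))^2) (at u)"
    "\<And>u. (G has_real_derivative g u) (at u)"
    "\<And>u. \<phi> (u + h) = \<phi> u - pi" "\<And>u. g (u + h) = g u"
    "\<And>u. \<beta> (u + h) = \<beta> u + b" "\<And>u. G (u + h) = G u - C * b / \<alpha>"
    "\<And>u. \<phi> (- u) = - \<phi> u" "\<And>u. g (- u) = g u" "\<And>u. \<beta> (- u) = - \<beta> u" "\<And>u. G (- u) = - G u"
proof -
  define \<theta> where "\<theta> = hc_theta \<alpha>"
  define c where "c = cos (2 * \<theta>)"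
  define w where "w p = sqrt (hc_P \<alpha> \<theta> (cos p))" for p
  have \<theta>: "0 < \<theta>" "\<theta> < hc_theta_plus \<alpha>" "\<theta> < pi / 4" "hc_L \<alpha> \<theta> = 0"
    using hc_theta_spec[OF a] by (auto simp: \<theta>_def)
  have CC: "C = hc_C \<alpha> \<theta>" by (simp add: C_def hc_CC_def \<theta>_def)
  have C: "C > 0" unfolding CC using a \<theta> by (intro hc_C_pos)
  have P: "hc_P \<alpha> \<theta> (cos p) > 0" for p
    using a \<theta> by (intro hc_P_pos) auto
  then have wpos: "w p > 0" for p by (simp add: w_def)
  have w_sq: "(w p)^2 = \<alpha>^2 + c * (cos p)^2 - C^2 * (cos p)^4" for p
    using P[of p] by (simp add: w_def hc_P_def c_def CC)
  have per: "w (p + pi) = w p" "w (p - pi) = w p" "w (- p) = w p" for p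
    by (simp_all add: w_def hc_P_def)
  have cont: "continuous_on UNIV w" unfolding w_def hc_P_def by (intro continuous_intros)
  obtain T where T: "T 0 = 0" "\<And>p. (T has_real_derivative 1 / w p) (at p)" "strict_mono T"
    "\<And>p. T (p + pi) = T p + T pi" "\<And>p. T (- p) = - T p"
    by (rule time_function_exists[OF cont wpos per(1,3)]) (rule that)
  have T_eq: "T p = T q \<longleftrightarrow> p = q" for p q using T(3) by (rule strict_mono_eq)
  define h where "h = T pi"
  have h: "h > 0" using strict_monoD[OF T(3), of 0 pi] T(1) by (simp add: h_def)

  have "\<phi> 0 = 0 \<and> (\<forall>u. \<phi> differentiable (at u)) \<and>
      (\<forall>u. (deriv \<phi> u)^2 = hc_P \<alpha> (hc_theta \<alpha>) (cos (\<phi> u))) \<and> deriv \<phi> 0 \<le> 0"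
    unfolding \<phi>_def hc_phi_def
    by (rule someI_ex[OF hc_phi_exists[OF P, unfolded \<theta>_def]])
  then have \<phi>: "\<phi> 0 = 0" "\<And>u. (\<phi> has_real_derivative deriv \<phi> u) (at u)"
    "\<And>u. (deriv \<phi> u)^2 = hc_P \<alpha> \<theta> (cos (\<phi> u))" "deriv \<phi> 0 \<le> 0"
    by (auto simp: \<theta>_def DERIV_deriv_iff_real_differentiable)
  have nz: "deriv \<phi> u \<noteq> 0" for u using \<phi>(3)[of u] P[of "\<phi> u"] by auto
  have "deriv \<phi> 0 < 0" using \<phi>(4) nz[of 0] by simp
  then have neg: "deriv \<phi> u < 0" for u using DERIV_nonzero_same_sign[OF \<phi>(2) nz] by blast
  have d\<phi>: "deriv \<phi> u = - w (\<phi> u)" for u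
    using neg[of u] real_sqrt_unique[of "- deriv \<phi> u" "hc_P \<alpha> \<theta> (cos (\<phi> u))"] \<phi>(3)[of u]
    by (simp add: w_def)
  \<comment> \<open>The composite has derivative -1, since \<open>\<phi>' = - w \<phi>\<close>.
    Injectivity of \<open>T\<close> then transfers its parity and its shift law to
    \<open>\<phi>\<close>.\<close>
  have T\<phi>: "T (\<phi> u) = - u" for u
  proof -
    have "((\<lambda>u. T (\<phi> u)) has_real_derivative -1) (at u)" for u
      using DERIV_chain2[OF T(2) \<phi>(2), of u] d\<phi>[of u] wpos[of "\<phi> u"] by simp
    moreover have "((\<lambda>u. - u) has_real_derivative -1) (at u)" for u :: real
      by (auto intro!: derivative_eq_intros)
    ultimately show ?thesis
      using DERIV_eq_imp_diff_const[of "\<lambda>u. T (\<phi> u)" "\<lambda>_. -1" uminus u 0] by (simp add: \<phi>(1) T(1))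
  qed
  have \<phi>_half: "\<phi> (u + h) = \<phi> u - pi" for u
  proof -
    have "T (\<phi> (u + h) + pi) = T (\<phi> u)" by (simp add: T(4) T\<phi> h_def)
    then show ?thesis by (simp add: T_eq)
  qed
  have \<phi>_odd: "\<phi> (- u) = - \<phi> u" for u
  proof -
    have "T (\<phi> (- u)) = T (- \<phi> u)" by (simp add: T\<phi> T(5))
    then show ?thesis by (simp add: T_eq)
  qed
  have \<phi>T: "\<phi> (T p) = - p" for p
  proof -
    have "T (\<phi> (T p)) = T (- p)" by (simp add: T\<phi> T(5))
    then show ?thesis by (simp add: T_eq)
  qed

  have g: "g u = (C^2 * (cos (\<phi> u))^2 - c) / (\<alpha> + w (\<phi> u))" for u
    using d\<phi>[of u] by (simp add: g_def hc_Gp_def \<phi>_def C_def c_def \<theta>_def)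
  have aw: "\<alpha> + w p > 0" for p using a wpos by (simp add: add_pos_pos)
  \<comment> \<open>The definition of \<open>P\<close> gives \<open>\<alpha>\<^sup>2 - w\<^sup>2 =
    x\<^sup>2 (C\<^sup>2 x\<^sup>2 - c)\<close>, whose left side contains the denominator
    \<open>\<alpha> + w\<close> of \<open>g\<close> as a factor.\<close>
  have yg: "(cos (\<phi> u))^2 * g u = \<alpha> - w (\<phi> u)" for u
  proof -
    have "(cos (\<phi> u))^2 * (C^2 * (cos (\<phi> u))^2 - c) = (\<alpha> - w (\<phi> u)) * (\<alpha> + w (\<phi> u))"
      using w_sq[of "\<phi> u"] by algebra
    then show ?thesis using aw[of "\<phi> u"] by (simp add: g field_simps)
  qed
  have \<phi>': "(\<phi> has_real_derivative (cos (\<phi> u))^2 * g u - \<alpha>) (at u)" for u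
    using \<phi>(2)[of u] by (simp add: yg d\<phi>)
  have g_half: "g (u + h) = g u" and g_odd: "g (- u) = g u" for u
    by (simp_all add: g \<phi>_half \<phi>_odd per)
  have g': "(g has_real_derivative ((g u)^2 + C^2) * sin (\<phi> u) * cos (\<phi> u)) (at u)" for u
  proof -
    define W where "W = w (\<phi> u)"
    have dw: "((\<lambda>u. w (\<phi> u)) has_real_derivative (c * cos (\<phi> u) - 2 * C^2 * (cos (\<phi> u))^3) * sin (\<phi> u)) (at u)"
    proof -
      have "((\<lambda>u. w (\<phi> u)) has_real_derivative
         ((c * (2 * cos (\<phi> u) * (- sin (\<phi> u) * deriv \<phi> u)) - C^2 * (4 * (cos (\<phi> u))^3 * (- sin (\<phi> u) * deriv \<phi> u)))
           * (inverse (w (\<phi> u)) / 2))) (at u)"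
        unfolding w_def hc_P_def c_def CC
        using P[of "\<phi> u"] \<phi>(2)[of u]
        by (auto intro!: derivative_eq_intros simp: hc_P_def field_simps)
      also have "(c * (2 * cos (\<phi> u) * (- sin (\<phi> u) * deriv \<phi> u)) - C^2 * (4 * (cos (\<phi> u))^3 * (- sin (\<phi> u) * deriv \<phi> u)))
           * (inverse (w (\<phi> u)) / 2) = (c * cos (\<phi> u) - 2 * C^2 * (cos (\<phi> u))^3) * sin (\<phi> u)"
        using wpos[of "\<phi> u"] by (simp add: d\<phi> field_simps)
      finally show ?thesis .
    qed
    have num: "((\<lambda>u. C^2 * (cos (\<phi> u))^2 - c) has_real_derivative 2 * C^2 * cos (\<phi> u) * sin (\<phi> u) * W) (at u)"
      using \<phi>(2)[of u] by (auto intro!: derivative_eq_intros simp: d\<phi> W_def)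
    have den: "((\<lambda>u. \<alpha> + w (\<phi> u)) has_real_derivative (c * cos (\<phi> u) - 2 * C^2 * (cos (\<phi> u))^3) * sin (\<phi> u)) (at u)"
      using DERIV_add[OF DERIV_const dw] by simp
    have "(g has_real_derivative
      (2 * C^2 * cos (\<phi> u) * sin (\<phi> u) * W * (\<alpha> + W)
        - (C^2 * (cos (\<phi> u))^2 - c) * ((c * cos (\<phi> u) - 2 * C^2 * (cos (\<phi> u))^3) * sin (\<phi> u)))
      / ((\<alpha> + W) * (\<alpha> + W))) (at u)"
      using DERIV_divide[OF num den] aw[of "\<phi> u"] unfolding W_def g[abs_def] by simp
    also have "2 * C^2 * cos (\<phi> u) * sin (\<phi> u) * W * (\<alpha> + W)
        - (C^2 * (cos (\<phi> u))^2 - c) * ((c * cos (\<phi> u) - 2 * C^2 * (cos (\<phi> u))^3) * sin (\<phi> u))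
      = ((C^2 * (cos (\<phi> u))^2 - c)^2 + C^2 * (\<alpha> + W)^2) * sin (\<phi> u) * cos (\<phi> u)"
      using w_sq[of "\<phi> u", folded W_def] by algebra
    also have "\<dots> / ((\<alpha> + W) * (\<alpha> + W)) = ((g u)^2 + C^2) * sin (\<phi> u) * cos (\<phi> u)"
      unfolding g W_def[symmetric] using aw[of "\<phi> u", folded W_def]
      by (simp add: divide_simps power2_eq_square)
    finally show ?thesis .
  qed

  have cont\<phi>: "isCont \<phi> u" for u using \<phi>(2) by (rule DERIV_isCont)
  have "\<exists>\<beta>. \<beta> 0 = 0 \<and> (\<forall>u. (\<beta> has_real_derivative C * (cos (\<phi> u))^2) (at u))"
    by (rule real_antiderivative[of "\<lambda>u. C * (cos (\<phi> u))^2"]) (intro continuous_intros cont\<phi>, blast)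
  from someI_ex[OF this] have \<beta>: "\<beta> 0 = 0" "\<And>u. (\<beta> has_real_derivative C * (cos (\<phi> u))^2) (at u)"
    unfolding \<beta>_def hc_beta_def C_def \<phi>_def by auto
  have "\<exists>G. G 0 = 0 \<and> (\<forall>u. (G has_real_derivative g u) (at u))"
    by (rule real_antiderivative[of g]) (rule DERIV_isCont[OF g'], blast)
  from someI_ex[OF this] have G: "G 0 = 0" "\<And>u. (G has_real_derivative g u) (at u)"
    unfolding G_def hc_G_def g_def by auto
  have \<beta>_half: "\<beta> (u + h) = \<beta> u + \<beta> h" and G_half: "G (u + h) = G u + G h" for u
  proof -
    have "((\<lambda>u. \<beta> (u + h)) has_real_derivative C * (cos (\<phi> u))^2) (at u)" for u
      using \<beta>(2)[of "u + h"] by (simp add: DERIV_shift \<phi>_half)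
    from DERIV_eq_imp_diff_const[OF this \<beta>(2), of u 0] show "\<beta> (u + h) = \<beta> u + \<beta> h"
      by (simp add: \<beta>(1))
    have "((\<lambda>u. G (u + h)) has_real_derivative g u) (at u)" for u
      using G(2)[of "u + h"] by (simp add: DERIV_shift g_half)
    from DERIV_eq_imp_diff_const[OF this G(2), of u 0] show "G (u + h) = G u + G h"
      by (simp add: G(1))
  qed
  have \<beta>_odd: "\<beta> (- u) = - \<beta> u" and G_odd: "G (- u) = - G u" for u
  proof -
    have "((\<lambda>u. - \<beta> (- u)) has_real_derivative C * (cos (\<phi> u))^2) (at u)" for u
      using DERIV_minus[of "\<lambda>u. \<beta> (- u)"] \<beta>(2)[of "- u"] by (fastforce simp: DERIV_mirror \<phi>_odd)
    from DERIV_eq_imp_diff_const[OF this \<beta>(2), of u 0] show "\<beta> (- u) = - \<beta> u"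
      by (simp add: \<beta>(1))
    have "((\<lambda>u. - G (- u)) has_real_derivative g u) (at u)" for u
      using DERIV_minus[of "\<lambda>u. G (- u)"] G(2)[of "- u"] by (fastforce simp: DERIV_mirror g_odd)
    from DERIV_eq_imp_diff_const[OF this G(2), of u 0] show "G (- u) = - G u"
      by (simp add: G(1))
  qed
  \<comment> \<open>Along \<open>u = T p\<close> the derivative of
    \<open>\<alpha> * G + C * \<beta>\<close> is
    \<open>(\<alpha> * g + C^2 * (cos p)^2) / w p\<close>. Over the common denominator
    \<open>w * (\<alpha> + w)\<close> this is the integrand of \<open>L\<close>, so the increment
    over [0, pi] is \<open>L\<close>, which is 0.\<close>
  have period: "\<alpha> * G h + C * \<beta> h = 0"
  proof -
    define K where "K p = \<alpha> * G (T p) + C * \<beta> (T p)" for p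
    have K: "(K has_real_derivative hc_f \<alpha> \<theta> (cos p)) (at p)" for p
    proof -
      have "(K has_real_derivative \<alpha> * (g (T p) * (1 / w p)) + C * (C * (cos (\<phi> (T p)))^2 * (1 / w p))) (at p)"
        unfolding K_def
        by (intro DERIV_add DERIV_cmult DERIV_chain2[OF G(2) T(2)] DERIV_chain2[OF \<beta>(2) T(2)])
      also have "\<alpha> * (g (T p) * (1 / w p)) + C * (C * (cos (\<phi> (T p)))^2 * (1 / w p)) = hc_f \<alpha> \<theta> (cos p)"
      proof -
        have 1: "g (T p) = (C^2 * (cos p)^2 - c) / (\<alpha> + w p)" by (simp add: g \<phi>T per)
        have 2: "hc_f \<alpha> \<theta> (cos p)
          = (2 * \<alpha> * C^2 * (cos p)^2 - \<alpha> * c + C^2 * (cos p)^2 * w p) / (w p * (\<alpha> + w p))"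
          by (simp add: hc_f_def w_def CC c_def)
        have 3: "w p \<noteq> 0" "\<alpha> + w p \<noteq> 0" using wpos[of p] aw[of p] by auto
        show ?thesis unfolding 1 2 \<phi>T using 3 by (simp add: divide_simps) (simp add: algebra_simps power2_eq_square)
      qed
      finally show ?thesis .
    qed
    have "((\<lambda>p. hc_f \<alpha> \<theta> (cos p)) has_integral K pi - K 0) {0..pi}"
      by (rule fundamental_theorem_of_calculus)
        (use K in \<open>auto simp: has_real_derivative_iff_has_vector_derivative[symmetric]
          intro: has_field_derivative_at_within\<close>)
    then have "hc_L \<alpha> \<theta> = K pi - K 0" using a \<theta> by (simp add: hc_L_eq integral_unique)
    then show ?thesis using \<theta>(4) by (simp add: K_def T(1) \<beta>(1) G(1) h_def)
  qed
  then have Gh: "G h = - (C * \<beta> h / \<alpha>)" using a by (simp add: field_simps)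
  show ?thesis
  proof (rule that[of h "\<beta> h"])
    show "(cos (\<phi> u))^2 * g u < \<alpha>" for u using yg[of u] wpos[of "\<phi> u"] by simp
    show "G (u + h) = G u - C * \<beta> h / \<alpha>" for u by (simp add: G_half Gh)
  qed (fact C h \<phi>' g' \<beta>(2) G(2) \<phi>_half g_half \<beta>_half \<phi>_odd g_odd \<beta>_odd G_odd)+
qed

subsection \<open>Curves turning once around\<close>

text \<open>A closed curve whose tangent direction turns monotonically once around is the boundary of its
  convex hull: the functional \<open>\<bullet> n u\<close>, for the outer normal \<open>n u\<close>, has a strict maximum over the
  curve at \<open>\<gamma> u\<close>. Central symmetry makes it enough to study half a turn.\<close>
locale turning_curve =
  fixes \<gamma> :: "real \<Rightarrow> real \<times> real" and \<rho> \<psi> :: "real \<Rightarrow> real" and h :: real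
  assumes h: "h > 0"
    and \<gamma>_deriv: "\<And>u. (\<gamma> has_vector_derivative \<rho> u *\<^sub>R (cos (\<psi> u), sin (\<psi> u))) (at u)"
    and \<rho>_pos: "\<And>u. \<rho> u > 0"
    and \<psi>_cont: "continuous_on UNIV \<psi>"
    and \<psi>_mono: "strict_mono \<psi>"
    and \<psi>_half: "\<And>u. \<psi> (u + h) = \<psi> u + pi"
    and \<gamma>_half: "\<And>u. \<gamma> (u + h) = - \<gamma> u"
begin

definition nrm :: "real \<Rightarrow> real \<times> real" where
  "nrm u = (sin (\<psi> u), - cos (\<psi> u))"

lemma \<gamma>_cont: "continuous_on S \<gamma>"
  using \<gamma>_deriv by (meson continuous_at_imp_continuous_on has_vector_derivative_continuous)

lemma height_deriv: "((\<lambda>s. \<gamma> s \<bullet> nrm u) has_real_derivative - (\<rho> s * sin (\<psi> s - \<psi> u))) (at s)"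
proof -
  have "((\<lambda>s. \<gamma> s \<bullet> nrm u) has_vector_derivative (\<rho> s *\<^sub>R (cos (\<psi> s), sin (\<psi> s))) \<bullet> nrm u) (at s)"
    by (rule bounded_linear.has_vector_derivative[OF bounded_linear_inner_left \<gamma>_deriv])
  then show ?thesis
    by (simp add: has_real_derivative_iff_has_vector_derivative nrm_def sin_diff algebra_simps)
qed

lemma height_decreasing:
  assumes "u \<le> s" "s < t" "t \<le> u + h"
  shows "\<gamma> t \<bullet> nrm u < \<gamma> s \<bullet> nrm u"
proof (rule DERIV_neg_imp_decreasing_open[OF assms(2)])
  fix x assume x: "s < x" "x < t"
  have "\<psi> u < \<psi> x" "\<psi> x < \<psi> (u + h)"
    using x assms \<psi>_mono by (auto simp: strict_mono_less)
  then have "sin (\<psi> x - \<psi> u) > 0" using \<psi>_half by (intro sin_gt_zero) auto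
  then show "\<exists>y. ((\<lambda>s. \<gamma> s \<bullet> nrm u) has_real_derivative y) (at x) \<and> y < 0"
    using height_deriv[of u x] \<rho>_pos[of x] by (intro exI conjI) (auto intro!: mult_pos_pos)
next
  show "continuous_on {s..t} (\<lambda>s. \<gamma> s \<bullet> nrm u)"
    by (intro continuous_intros \<gamma>_cont)
qed

lemma height_less:
  assumes "u < s" "s < u + 2 * h"
  shows "\<gamma> s \<bullet> nrm u < \<gamma> u \<bullet> nrm u"
proof (cases "s \<le> u + h")
  case True
  then show ?thesis using assms by (intro height_decreasing) auto
next
  case False
  \<comment> \<open>Negating both points by central symmetry turns this into the claim.\<close>
  have "\<gamma> (u + h) \<bullet> nrm u < \<gamma> (s - h) \<bullet> nrm u"
    using assms False by (intro height_decreasing) auto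
  then show ?thesis using \<gamma>_half[of u] \<gamma>_half[of "s - h"] by simp
qed

lemma periodic_int: "\<gamma> (u + of_int n * (2 * h)) = \<gamma> u"
proof -
  have step: "\<gamma> (u + 2 * h) = \<gamma> u" for u
    using \<gamma>_half[of u] \<gamma>_half[of "u + h"] by (simp add: algebra_simps)
  show ?thesis
  proof (induction n rule: int_induct[where k = 0])
    case (step1 i)
    then show ?case using step[of "u + of_int i * (2*h)"] by (simp add: algebra_simps)
  next
    case (step2 i)
    then show ?case using step[of "u + of_int (i-1) * (2*h)"] by (simp add: algebra_simps)
  qed simp
qed

lemma reduce_period:
  obtains n :: int where "a \<le> u + of_int n * (2 * h)" "u + of_int n * (2 * h) < a + 2 * h"
proof -
  define n where "n = \<lceil>(a - u) / (2 * h)\<rceil>"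
  have "(a - u) / (2 * h) \<le> of_int n" "of_int n < (a - u) / (2 * h) + 1"
    unfolding n_def by linarith+
  then show ?thesis using h that[of n] by (simp add: field_simps)
qed

text \<open>Move \<open>s\<close> by periods into [\<open>u\<close>, \<open>u + 2 * h\<close>);
  there the height is strictly below its value at \<open>u\<close>, except at \<open>u\<close>
  itself.\<close>

lemma eq_imp_period:
  assumes "\<gamma> s = \<gamma> u"
  obtains n :: int where "s = u + of_int n * (2 * h)"
proof -
  obtain n where n: "u \<le> s + of_int n * (2 * h)" "s + of_int n * (2 * h) < u + 2 * h"
    using reduce_period by blast
  have "\<gamma> (s + of_int n * (2 * h)) = \<gamma> u" using assms periodic_int by simp
  then have "\<not> u < s + of_int n * (2 * h)"
    using height_less[OF _ n(2)] by auto
  then have "s = u + of_int (-n) * (2 * h)" using n by simp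
  then show ?thesis using that by blast
qed

lemma height_le: "\<gamma> s \<bullet> nrm u \<le> \<gamma> u \<bullet> nrm u" and
  height_eq_imp: "\<gamma> s \<bullet> nrm u = \<gamma> u \<bullet> nrm u \<Longrightarrow> \<gamma> s = \<gamma> u"
proof -
  obtain n where n: "u \<le> s + of_int n * (2 * h)" "s + of_int n * (2 * h) < u + 2 * h"
    using reduce_period by blast
  have s: "\<gamma> s = \<gamma> (s + of_int n * (2 * h))" using periodic_int by simp
  have "\<gamma> s = \<gamma> u \<or> \<gamma> s \<bullet> nrm u < \<gamma> u \<bullet> nrm u"
  proof (cases "s + of_int n * (2 * h) = u")
    case False
    then show ?thesis using n height_less[of u "s + of_int n * (2 * h)"] unfolding s by auto
  qed (use s in auto)
  then show "\<gamma> s \<bullet> nrm u \<le> \<gamma> u \<bullet> nrm u"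
    "\<gamma> s \<bullet> nrm u = \<gamma> u \<bullet> nrm u \<Longrightarrow> \<gamma> s = \<gamma> u" by auto
qed

lemma height_pos: "\<gamma> u \<bullet> nrm u > 0"
  using height_decreasing[of u u "u + h"] h \<gamma>_half[of u] by simp

lemma range_eq: "range \<gamma> = \<gamma> ` {a..a + 2 * h}"
proof -
  have "\<gamma> u \<in> \<gamma> ` {a..a + 2 * h}" for u
  proof -
    obtain n where "a \<le> u + of_int n * (2 * h)" "u + of_int n * (2 * h) < a + 2 * h"
      using reduce_period by blast
    then have "u + of_int n * (2 * h) \<in> {a..a + 2 * h}" by simp
    then show ?thesis using periodic_int[of u n] by (metis imageI)
  qed
  then show ?thesis by auto
qed

lemma compact_range: "compact (range \<gamma>)"
  unfolding range_eq[of 0] by (intro compact_continuous_image \<gamma>_cont) auto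

text \<open>Every direction is an outer normal of the curve: \<open>\<psi>\<close> is continuous and
  gains \<open>2 * pi\<close> over a period, so it takes some representative of any given
  angle.\<close>

lemma nrm_surj:
  assumes "a \<noteq> 0"
  obtains u where "a = norm a *\<^sub>R nrm u"
proof -
  obtain x y where a: "a = (x, y)" by force
  have n: "norm a > 0" using assms by simp
  have n2: "(norm a)^2 = x^2 + y^2" by (simp add: a norm_Pair)
  have "(- y / norm a)^2 + (x / norm a)^2 = 1"
  proof -
    have "(- y / norm a)^2 + (x / norm a)^2 = (x^2 + y^2) / (norm a)^2"
      by (simp add: power_divide add_divide_distrib)
    then show ?thesis using n unfolding n2[symmetric] by simp
  qed
  then obtain t where t: "- y / norm a = cos t" "x / norm a = sin t"
    by (rule sincos_total_2pi)
  obtain n where n1: "\<psi> 0 \<le> t + of_int n * (2 * pi)" "t + of_int n * (2 * pi) < \<psi> 0 + 2 * pi"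
  proof -
    define n where "n = \<lceil>(\<psi> 0 - t) / (2 * pi)\<rceil>"
    have "(\<psi> 0 - t) / (2 * pi) \<le> of_int n" "of_int n < (\<psi> 0 - t) / (2 * pi) + 1"
      unfolding n_def by linarith+
    then show ?thesis using that[of n] by (simp add: field_simps)
  qed
  have "\<psi> (2 * h) = \<psi> 0 + 2 * pi" using \<psi>_half[of 0] \<psi>_half[of h] by (simp add: algebra_simps)
  then have "\<exists>u. 0 \<le> u \<and> u \<le> 2 * h \<and> \<psi> u = t + of_int n * (2 * pi)"
    using n1 h by (intro IVT' continuous_on_subset[OF \<psi>_cont]) auto
  then obtain u where u: "\<psi> u = t + of_int n * (2 * pi)" by blast
  have "sin (\<psi> u) = sin t" "cos (\<psi> u) = cos t"
    using sin_int_2pin[of n] cos_int_2pin[of n]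
    by (simp_all add: u sin_add cos_add mult.commute)
  then have "a = norm a *\<^sub>R nrm u" using n by (simp add: nrm_def a t[symmetric])
  then show ?thesis using that by blast
qed

lemma hull_height_le: "p \<in> convex hull (range \<gamma>) \<Longrightarrow> p \<bullet> nrm u \<le> \<gamma> u \<bullet> nrm u"
proof -
  assume "p \<in> convex hull (range \<gamma>)"
  moreover have "convex hull (range \<gamma>) \<subseteq> {p. nrm u \<bullet> p \<le> \<gamma> u \<bullet> nrm u}"
    using height_le by (intro hull_minimal convex_halfspace_le) (auto simp: inner_commute)
  ultimately show ?thesis by (auto simp: inner_commute)
qed

text \<open>In a convex combination that attains the maximal height, points of smaller height have
  weight 0, and \<open>\<gamma> u\<close> is the only curve point of maximal height.\<close>

lemma hull_height_eq:
  assumes "p \<in> convex hull (range \<gamma>)" "p \<bullet> nrm u = \<gamma> u \<bullet> nrm u"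
  shows "p = \<gamma> u"
proof -
  obtain S c where S: "finite S" "S \<subseteq> range \<gamma>" "\<forall>x\<in>S. 0 \<le> c x" "sum c S = 1" "(\<Sum>v\<in>S. c v *\<^sub>R v) = p"
    using assms(1) unfolding convex_hull_explicit by blast
  have "(\<Sum>v\<in>S. c v * (\<gamma> u \<bullet> nrm u - v \<bullet> nrm u)) = \<gamma> u \<bullet> nrm u * sum c S - (\<Sum>v\<in>S. c v *\<^sub>R v) \<bullet> nrm u"
    by (simp add: right_diff_distrib sum_subtractf sum_distrib_right[symmetric] inner_sum_left mult.commute)
  also have "\<dots> = 0" using S assms by simp
  finally have "\<forall>v\<in>S. c v * (\<gamma> u \<bullet> nrm u - v \<bullet> nrm u) = 0"
    using S height_le by (subst (asm) sum_nonneg_eq_0_iff) (auto intro!: mult_nonneg_nonneg)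
  then have "\<forall>v\<in>S. c v *\<^sub>R v = c v *\<^sub>R \<gamma> u"
    using S(2) height_eq_imp by fastforce
  then have "p = (\<Sum>v\<in>S. c v *\<^sub>R \<gamma> u)" using S by (metis (no_types, lifting) sum.cong)
  then show ?thesis using S by (simp add: scaleR_left.sum[symmetric])
qed

text \<open>A frontier point has a supporting line; its outward direction is a multiple of some
  \<open>nrm u\<close>, and the height in that direction is maximal on the hull only at
  \<open>\<gamma> u\<close>. Conversely, moving from \<open>\<gamma> u\<close> along
  \<open>nrm u\<close> leaves the hull. The origin is in the hull as the midpoint of
  \<open>\<gamma> 0\<close> and \<open>\<gamma> h\<close>, and off the curve because heights on the
  curve are positive.\<close>

lemma zero_in_interior: "0 \<in> interior (convex hull (range \<gamma>))"
  and frontier_hull: "frontier (convex hull (range \<gamma>)) = range \<gamma>"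
proof -
  let ?D = "convex hull (range \<gamma>)"
  have comp: "compact ?D" using compact_range by (rule compact_convex_hull)
  have bd: "p \<in> range \<gamma>" if p: "p \<in> frontier ?D" for p
  proof -
    have "p \<in> ?D"
      using p comp by (metis compact_imp_closed frontier_subset_closed subsetD)
    obtain a where a: "a \<noteq> 0" "\<And>y. y \<in> ?D \<Longrightarrow> a \<bullet> p \<le> a \<bullet> y"
    \<comment> \<open>A hull without interior lies in a line, which then serves as the supporting
      line.\<close>
    proof (cases "interior ?D = {}")
      case True
      then obtain a b where "a \<noteq> 0" "?D \<subseteq> {x. a \<bullet> x = b}"
        using empty_interior_subset_hyperplane[OF convex_convex_hull True] by blast
      have eq: "a \<bullet> y = b" if "y \<in> ?D" for y
        using subsetD[OF \<open>?D \<subseteq> {x. a \<bullet> x = b}\<close> that] by simp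
      have "a \<bullet> p \<le> a \<bullet> y" if "y \<in> ?D" for y
        using eq[OF \<open>p \<in> ?D\<close>] eq[OF that] by simp
      with \<open>a \<noteq> 0\<close> show ?thesis by (rule that)
    next
      case False
      then have "p \<notin> rel_interior ?D"
        using p by (simp add: frontier_def rel_interior_nonempty_interior)
      show ?thesis
        by (rule supporting_hyperplane_rel_boundary[OF convex_convex_hull \<open>p \<in> ?D\<close> \<open>p \<notin> rel_interior ?D\<close>])
          (rule that)
    qed
    obtain u where u: "- a = norm a *\<^sub>R nrm u" using nrm_surj[of "-a"] a by auto
    have "- a \<bullet> \<gamma> u \<le> - a \<bullet> p" using a(2)[of "\<gamma> u"] by (simp add: hull_inc)
    then have "nrm u \<bullet> \<gamma> u \<le> nrm u \<bullet> p" using a(1) unfolding u by simp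
    then have "p \<bullet> nrm u = \<gamma> u \<bullet> nrm u"
      using hull_height_le[OF \<open>p \<in> ?D\<close>, of u] by (simp add: inner_commute)
    then show ?thesis using hull_height_eq[OF \<open>p \<in> ?D\<close>] by blast
  qed
  have "\<gamma> u \<notin> interior ?D" for u
  proof
    assume "\<gamma> u \<in> interior ?D"
    then obtain e where e: "e > 0" "cball (\<gamma> u) e \<subseteq> ?D" using mem_interior_cball by blast
    have nn: "nrm u \<bullet> nrm u = 1" by (simp add: nrm_def power2_eq_square[symmetric])
    have "\<gamma> u + e *\<^sub>R nrm u \<in> ?D"
      using e nn by (intro subsetD[OF e(2)]) (simp add: dist_norm norm_eq_sqrt_inner)
    from hull_height_le[OF this, of u] show False using e nn by (simp add: inner_add_left)
  qed
  then show "frontier ?D = range \<gamma>"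
    using bd closure_subset[of ?D] hull_inc[of _ "range \<gamma>" convex]
    unfolding frontier_def by blast
  have "0 = (1/2) *\<^sub>R \<gamma> 0 + (1/2) *\<^sub>R \<gamma> h" using \<gamma>_half[of 0] by simp
  also have "\<dots> \<in> ?D"
    by (rule convexD) (auto simp: hull_inc)
  finally have "0 \<in> ?D" .
  moreover have "0 \<notin> range \<gamma>" using height_pos by (metis inner_zero_left less_irrefl rangeE)
  ultimately show "0 \<in> interior ?D"
    using \<open>frontier ?D = range \<gamma>\<close> closure_subset[of ?D] unfolding frontier_def by blast
qed

lemma zero_in_inside: "0 \<in> inside (range \<gamma>)"
proof -
  have "inside (frontier (convex hull (range \<gamma>))) = interior (convex hull (range \<gamma>))"
    by (intro inside_frontier_eq_interior compact_imp_bounded compact_convex_hull compact_range)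
      (rule convex_convex_hull)
  then show ?thesis using zero_in_interior by (simp add: frontier_hull)
qed

lemma convex_region:
  "\<exists>D. convex D \<and> compact D \<and> interior D \<noteq> {} \<and> frontier D = range \<gamma>"
  using frontier_hull zero_in_interior compact_convex_hull[OF compact_range] convex_convex_hull
  by (metis empty_iff)

lemma simple_closed_path:
  "\<exists>g. simple_path g \<and> pathfinish g = pathstart g \<and> path_image g = range \<gamma>"
proof (intro exI conjI)
  let ?g = "\<lambda>t. \<gamma> (2 * h * t)"
  show "pathfinish ?g = pathstart ?g"
    using periodic_int[of 0 1] by (simp add: pathfinish_def pathstart_def)
  have "(\<lambda>t. 2 * h * t) ` {0..1} = {0..0 + 2 * h}"
    using h by (simp add: image_mult_atLeastAtMost)
  then show "path_image ?g = range \<gamma>"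
    using image_image[of \<gamma> "\<lambda>t. 2 * h * t" "{0..1}"]
    by (simp only: range_eq[of 0] path_image_def)
  show "simple_path ?g"
    unfolding simple_path_def loop_free_def
  proof (intro conjI ballI impI)
    show "path ?g" unfolding path_def by (intro continuous_on_compose2[OF \<gamma>_cont] continuous_intros) auto
    fix x y :: real assume xy: "x \<in> {0..1}" "y \<in> {0..1}" "\<gamma> (2 * h * x) = \<gamma> (2 * h * y)"
    obtain n :: int where "2 * h * x = 2 * h * y + of_int n * (2 * h)"
      using eq_imp_period[OF xy(3)] by blast
    then have "2 * h * x = 2 * h * (y + of_int n)" by (simp add: algebra_simps)
    then have n: "x = y + of_int n" using h by simp
    then have "of_int (-1) \<le> (of_int n :: real)" "(of_int n :: real) \<le> of_int 1" using xy by auto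
    then have "n = -1 \<or> n = 0 \<or> n = 1" unfolding of_int_le_iff by linarith
    then show "x = y \<or> x = 0 \<and> y = 1 \<or> x = 1 \<and> y = 0" using n xy by auto
  qed
qed

end

subsection \<open>Conformal parametrizations in Nil\<close>

lemma nil_g_simps:
  "nil_g p 1 1 = 1 + (p$2)^2 / 4" "nil_g p 1 2 = - (p$1 * p$2) / 4" "nil_g p 1 3 = p$2 / 2"
  "nil_g p 2 1 = - (p$1 * p$2) / 4" "nil_g p 2 2 = 1 + (p$1)^2 / 4" "nil_g p 2 3 = - (p$1) / 2"
  "nil_g p 3 1 = p$2 / 2" "nil_g p 3 2 = - (p$1) / 2" "nil_g p 3 3 = 1"
  by (simp_all add: nil_g_def nil_metric_def nil_form_def axis_def power2_eq_square)

lemma nil_dg_simps: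
  "nil_dg 1 p 1 1 = 0" "nil_dg 1 p 1 2 = - (p$2) / 4" "nil_dg 1 p 1 3 = 0"
  "nil_dg 1 p 2 1 = - (p$2) / 4" "nil_dg 1 p 2 2 = p$1 / 2" "nil_dg 1 p 2 3 = - 1 / 2"
  "nil_dg 1 p 3 1 = 0" "nil_dg 1 p 3 2 = - 1 / 2" "nil_dg 1 p 3 3 = 0"
  "nil_dg 2 p 1 1 = p$2 / 2" "nil_dg 2 p 1 2 = - (p$1) / 4" "nil_dg 2 p 1 3 = 1 / 2"
  "nil_dg 2 p 2 1 = - (p$1) / 4" "nil_dg 2 p 2 2 = 0" "nil_dg 2 p 2 3 = 0"
  "nil_dg 2 p 3 1 = 1 / 2" "nil_dg 2 p 3 2 = 0" "nil_dg 2 p 3 3 = 0"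
  "nil_dg 3 p i j = 0"
  unfolding nil_dg_def nil_g_simps
  by (rule DERIV_imp_deriv, (auto simp: axis_def nil_g_def nil_metric_def nil_form_def intro!: derivative_eq_intros)[1])+

lemma nil_christoffel1_simps:
  "nil_christoffel1 p 1 1 1 = 0" "nil_christoffel1 p 1 1 2 = p$2 / 4" "nil_christoffel1 p 1 1 3 = 0"
  "nil_christoffel1 p 1 2 1 = p$2 / 4" "nil_christoffel1 p 1 2 2 = - (p$1) / 2" "nil_christoffel1 p 1 2 3 = 1 / 2"
  "nil_christoffel1 p 1 3 1 = 0" "nil_christoffel1 p 1 3 2 = 1 / 2" "nil_christoffel1 p 1 3 3 = 0"
  "nil_christoffel1 p 2 1 1 = - (p$2) / 2" "nil_christoffel1 p 2 1 2 = p$1 / 4" "nil_christoffel1 p 2 1 3 = - 1 / 2"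
  "nil_christoffel1 p 2 2 1 = p$1 / 4" "nil_christoffel1 p 2 2 2 = 0" "nil_christoffel1 p 2 2 3 = 0"
  "nil_christoffel1 p 2 3 1 = - 1 / 2" "nil_christoffel1 p 2 3 2 = 0" "nil_christoffel1 p 2 3 3 = 0"
  "nil_christoffel1 p 3 i j = 0"
  using exhaust_3[of i] exhaust_3[of j]
  by (auto simp: nil_christoffel1_def nil_dg_simps)

text \<open>The Euler--Lagrange expression of \<open>(x\<^sub>1'\<^sup>2 + x\<^sub>2'\<^sup>2 + \<eta>\<^sup>2) / 2\<close> with \<open>\<eta> = nil_form x x'\<close>, paired with \<open>N\<close>.\<close>
definition nil_accel :: "real^3 \<Rightarrow> real^3 \<Rightarrow> real^3 \<Rightarrow> real^3 \<Rightarrow> real" where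
  "nil_accel p V W N = W$1 * N$1 + W$2 * N$2 + nil_form p W * nil_form p N
     + nil_form p V * (V$2 * N$1 - V$1 * N$2)"

lemma nil_hess_low_pairing:
  "(\<Sum>l\<in>UNIV. nil_hess_low F D D z l * N$l) = nil_accel (F z) (D F z) (D (D F) z) N"
proof -
  have "nil_hess_low F D D z 1 = D (D F) z $ 1 + nil_form (F z) (D (D F) z) * (F z $ 2) / 2
      + nil_form (F z) (D F z) * D F z $ 2"
    unfolding nil_hess_low_def sum_3 nil_christoffel1_simps nil_g_simps nil_form_def
    by (simp add: field_simps power2_eq_square)
  moreover have "nil_hess_low F D D z 2 = D (D F) z $ 2 - nil_form (F z) (D (D F) z) * (F z $ 1) / 2
      - nil_form (F z) (D F z) * D F z $ 1"
    unfolding nil_hess_low_def sum_3 nil_christoffel1_simps nil_g_simps nil_form_def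
    by (simp add: field_simps power2_eq_square)
  moreover have "nil_hess_low F D D z 3 = nil_form (F z) (D (D F) z)"
    unfolding nil_hess_low_def sum_3 nil_christoffel1_simps nil_g_simps nil_form_def
    by (simp add: field_simps power2_eq_square)
  moreover have alg: "(a + e * q / 2 + f * v) * l + (b - e * p / 2 - f * u) * m + e * n
      = a * l + b * m + e * (n + (q * l - p * m) / 2) + f * (v * l - u * m)"
    for a b e f l m n p q u v :: real
    by (simp add: field_simps)
  ultimately show ?thesis
    by (simp add: sum_3 nil_accel_def nil_form_def[of _ N] alg)
qed

text \<open>A conformal harmonic map is minimal: with \<open>h11 = h22\<close> and
  \<open>h12 = 0\<close> the mean curvature covector is \<open>h11\<close> times the sum of the two
  covariant accelerations.\<close>

lemma nil_minimal_conformal: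
  assumes "nil_metric (F z) (D1 F z) (D1 F z) = nil_metric (F z) (D2 F z) (D2 F z)"
    "nil_metric (F z) (D1 F z) (D2 F z) = 0"
    "nil_accel (F z) (D1 F z) (D1 (D1 F) z) N + nil_accel (F z) (D2 F z) (D2 (D2 F) z) N = 0"
  shows "(\<Sum>l\<in>UNIV. nil_mean_curv_low F z l * N $ l) = 0"
proof -
  have "(\<Sum>l\<in>UNIV. nil_mean_curv_low F z l * N $ l)
     = nil_metric (F z) (D1 F z) (D1 F z) *
       ((\<Sum>l\<in>UNIV. nil_hess_low F D1 D1 z l * N$l) + (\<Sum>l\<in>UNIV. nil_hess_low F D2 D2 z l * N$l))"
    unfolding nil_mean_curv_low_def assms(1)[symmetric] assms(2)
    by (simp add: sum.distrib sum_distrib_left algebra_simps)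
  then show ?thesis using assms(3) by (simp add: nil_hess_low_pairing)
qed

section \<open>Calculus of partial derivatives on the complex plane\<close>

definition has_partials :: "(complex \<Rightarrow> 'a::real_normed_vector) \<Rightarrow> 'a \<Rightarrow> 'a \<Rightarrow> complex \<Rightarrow> bool" where
  "has_partials f p q w \<longleftrightarrow> (f has_derivative (\<lambda>d. Re d *\<^sub>R p + Im d *\<^sub>R q)) (at w)"

lemma has_partials_cong: "has_partials f p q w \<Longrightarrow> p = p' \<Longrightarrow> q = q' \<Longrightarrow> has_partials f p' q' w"
  by simp

lemma has_partials_const: "has_partials (\<lambda>w. c) 0 0 w"
  by (simp add: has_partials_def)

lemma has_partials_Im: "has_partials Im 0 1 w"
  by (auto simp: has_partials_def intro!: derivative_eq_intros)

lemma has_partials_Re: "(f has_real_derivative D) (at (Re w)) \<Longrightarrow> has_partials (\<lambda>w. f (Re w)) D 0 w"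
  unfolding has_partials_def
  by (rule has_derivative_eq_rhs, erule DERIV_compose_FDERIV) (auto intro!: derivative_eq_intros simp: mult.commute)

lemma has_partials_chain:
  fixes h :: "complex \<Rightarrow> real"
  assumes "(f has_real_derivative D) (at (h w))" "has_partials h p q w"
  shows "has_partials (\<lambda>w. f (h w)) (D * p) (D * q) w"
  using DERIV_compose_FDERIV[OF assms(1) assms(2)[unfolded has_partials_def]]
  unfolding has_partials_def by (rule has_derivative_eq_rhs) (auto simp: algebra_simps)

lemma has_partials_add:
  "has_partials f p q w \<Longrightarrow> has_partials g p' q' w \<Longrightarrow> has_partials (\<lambda>w. f w + g w) (p + p') (q + q') w"
  unfolding has_partials_def
  by (rule has_derivative_eq_rhs, erule (1) has_derivative_add) (auto simp: algebra_simps)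

lemma has_partials_diff:
  "has_partials f p q w \<Longrightarrow> has_partials g p' q' w \<Longrightarrow> has_partials (\<lambda>w. f w - g w) (p - p') (q - q') w"
  unfolding has_partials_def
  by (rule has_derivative_eq_rhs, erule (1) has_derivative_diff) (auto simp: algebra_simps)

lemma has_partials_uminus:
  "has_partials f p q w \<Longrightarrow> has_partials (\<lambda>w. - f w) (- p) (- q) w"
  unfolding has_partials_def
  by (rule has_derivative_eq_rhs, erule has_derivative_minus) (auto simp: algebra_simps)

lemma has_partials_scaleR:
  fixes f :: "complex \<Rightarrow> real"
  shows "has_partials f p q w \<Longrightarrow> has_partials g p' q' w \<Longrightarrow>
    has_partials (\<lambda>w. f w *\<^sub>R g w) (p *\<^sub>R g w + f w *\<^sub>R p') (q *\<^sub>R g w + f w *\<^sub>R q') w"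
  unfolding has_partials_def
  by (rule has_derivative_eq_rhs, erule (1) has_derivative_scaleR) (auto simp: algebra_simps)

lemma has_partials_mult:
  fixes f :: "complex \<Rightarrow> real"
  shows "has_partials f p q w \<Longrightarrow> has_partials g p' q' w \<Longrightarrow>
    has_partials (\<lambda>w. f w * g w) (p * g w + f w * p') (q * g w + f w * q') w"
  using has_partials_scaleR[of f p q w g] by simp

lemma vector_3_eq_axis: "(vector [a, b, c] :: real^3) = a *\<^sub>R axis 1 1 + b *\<^sub>R axis 2 1 + c *\<^sub>R axis 3 1"
  by (simp add: vec_eq_iff forall_3 axis_def)

lemma has_partials_vector:
  fixes f1 f2 f3 :: "complex \<Rightarrow> real"
  assumes "has_partials f1 p1 q1 w" "has_partials f2 p2 q2 w" "has_partials f3 p3 q3 w"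
  shows "has_partials (\<lambda>w. vector [f1 w, f2 w, f3 w] :: real^3) (vector [p1, p2, p3]) (vector [q1, q2, q3]) w"
  unfolding vector_3_eq_axis
  by (rule has_partials_cong, (rule has_partials_add has_partials_scaleR has_partials_const assms)+) simp_all

lemma D1_eq: "has_partials f p q w \<Longrightarrow> D1 f w = p"
  unfolding has_partials_def D1_def by (drule frechet_derivative_at, drule sym, simp)

lemma D2_eq: "has_partials f p q w \<Longrightarrow> D2 f w = q"
  unfolding has_partials_def D2_def by (drule frechet_derivative_at, drule sym, simp)

lemma has_partials_differentiable: "has_partials f p q w \<Longrightarrow> f differentiable (at w)"
  unfolding has_partials_def differentiable_def by blast

lemma has_partials_isCont: "has_partials f p q w \<Longrightarrow> isCont f w"
  unfolding has_partials_def by (rule has_derivative_continuous)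

lemma has_partials_unique:
  "has_partials f p q w \<Longrightarrow> has_partials f p' q' w \<Longrightarrow> p = p' \<and> q = q'"
  by (metis D1_eq D2_eq)

lemma has_partials_transform:
  "has_partials f p q w \<Longrightarrow> open S \<Longrightarrow> w \<in> S \<Longrightarrow> (\<And>x. x \<in> S \<Longrightarrow> f x = g x) \<Longrightarrow> has_partials g p q w"
  unfolding has_partials_def by (rule has_derivative_transform_within_open)

text \<open>By the Cauchy-Riemann equations, a holomorphic change of variable acts on the pair of
  partials as a rotation with scaling by \<open>m\<close>.\<close>

lemma has_partials_holomorphic:
  assumes "has_partials f p q (k z)" "(k has_field_derivative m) (at z)"
  shows "has_partials (\<lambda>z. f (k z)) (Re m *\<^sub>R p + Im m *\<^sub>R q) (- Im m *\<^sub>R p + Re m *\<^sub>R q) z"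
proof -
  have "((\<lambda>z. f (k z)) has_derivative (\<lambda>d. Re (m * d) *\<^sub>R p + Im (m * d) *\<^sub>R q)) (at z)"
    using has_derivative_compose[OF assms(2)[unfolded has_field_derivative_def] assms(1)[unfolded has_partials_def]]
    by simp
  then show ?thesis
    unfolding has_partials_def by (rule has_derivative_eq_rhs) (auto simp: algebra_simps)
qed

lemma has_partials_Re_holomorphic:
  "(k has_field_derivative m) (at z) \<Longrightarrow> has_partials (\<lambda>z. Re (k z)) (Re m) (- Im m) z"
  unfolding has_partials_def has_field_derivative_def
  by (drule has_derivative_Re) (simp add: algebra_simps)

lemma has_partials_Im_holomorphic:
  "(k has_field_derivative m) (at z) \<Longrightarrow> has_partials (\<lambda>z. Im (k z)) (Im m) (Re m) z"
  unfolding has_partials_def has_field_derivative_def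
  by (drule has_derivative_Im) (simp add: algebra_simps)

text \<open>Functions on \<open>\<complex>\<close> with period \<open>2 \<pi> \<i> \<kappa>\<close> descend along \<open>w \<mapsto> exp (w / \<kappa>)\<close> to \<open>\<complex> - {0}\<close>.\<close>
definition descend :: "complex \<Rightarrow> (complex \<Rightarrow> 'a) \<Rightarrow> complex \<Rightarrow> 'a" where
  "descend \<kappa> B z = B (\<kappa> * Ln z)"

definition log_periodic :: "complex \<Rightarrow> (complex \<Rightarrow> 'a) \<Rightarrow> bool" where
  "log_periodic \<kappa> B \<longleftrightarrow> (\<forall>w. B (w + \<kappa> * (2 * of_real pi * \<i>)) = B w)"

lemma log_periodic_int: "log_periodic \<kappa> B \<Longrightarrow> B (w + \<kappa> * (2 * of_int n * of_real pi * \<i>)) = B w"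
proof (induction n rule: int_induct[where k = 0])
  case (step1 i)
  have "B (w + \<kappa> * (2 * of_int i * of_real pi * \<i>) + \<kappa> * (2 * of_real pi * \<i>)) = B (w + \<kappa> * (2 * of_int i * of_real pi * \<i>))"
    using step1(3) unfolding log_periodic_def by blast
  then show ?case using step1 by (simp add: algebra_simps)
next
  case (step2 i)
  have "B (w + \<kappa> * (2 * of_int (i-1) * of_real pi * \<i>) + \<kappa> * (2 * of_real pi * \<i>)) = B (w + \<kappa> * (2 * of_int (i-1) * of_real pi * \<i>))"
    using step2(3) unfolding log_periodic_def by blast
  then show ?case using step2 by (simp add: algebra_simps)
qed simp

text \<open>Two logarithms of \<open>z\<close> differ by a multiple of \<open>2 * pi * \<i>\<close>,
  which the period of \<open>B\<close> absorbs. Hence the branch cut of \<open>Ln\<close> leaves no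
  trace in \<open>descend\<close>, and local branches may be used instead.\<close>

lemma descend_exp:
  assumes "log_periodic \<kappa> B" "exp v = z"
  shows "descend \<kappa> B z = B (\<kappa> * v)"
proof -
  have "exp (Ln z) = exp v" using assms(2) by auto
  then obtain n where "Ln z = v + of_real (real_of_int (2 * n) * pi) * \<i>"
    unfolding exp_eq by blast
  then have "\<kappa> * Ln z = \<kappa> * v + \<kappa> * (2 * of_int n * of_real pi * \<i>)"
    by (simp add: algebra_simps)
  then show ?thesis unfolding descend_def by (simp only: log_periodic_int[OF assms(1)])
qed

text \<open>For \<open>x\<close> in the ball around \<open>z\<close> of radius
  \<open>norm z\<close>, the quotient \<open>x / z\<close> has positive real part, so
  \<open>Ln z + Ln (x / z)\<close> is a branch of the logarithm there, also when \<open>z\<close>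
  lies on the cut of \<open>Ln\<close>.\<close>

lemma local_log:
  assumes "z \<noteq> (0::complex)"
  obtains k S where "open S" "z \<in> S" "\<And>x. x \<in> S \<Longrightarrow> exp (k x) = x" "(k has_field_derivative 1 / z) (at z)"
    "continuous_on S k" "k z = Ln z"
proof -
  have e: "exp (Ln z) = z" using assms by simp
  show ?thesis
  proof (rule that[of "ball z (norm z)" "\<lambda>x. Ln z + Ln (x / z)"])
    show "z \<in> ball z (norm z)" using assms by simp
    have ne: "x \<noteq> 0" "x / z \<notin> \<real>\<^sub>\<le>\<^sub>0" if "x \<in> ball z (norm z)" for x
    proof -
      show "x \<noteq> 0" using that by auto
      have "norm (1 - x / z) < 1"
      proof -
        have "1 - x / z = (z - x) / z" using assms by (simp add: field_simps)
        then show ?thesis using that assms by (simp add: norm_divide dist_norm)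
      qed
      then have "Re (x / z) > 0" using complex_Re_le_cmod[of "1 - x / z"] by simp
      then show "x / z \<notin> \<real>\<^sub>\<le>\<^sub>0" by (auto simp: complex_nonpos_Reals_iff)
    qed
    show "exp (Ln z + Ln (x / z)) = x" if "x \<in> ball z (norm z)" for x
      using ne[OF that] assms by (simp add: exp_add)
    show "((\<lambda>x. Ln z + Ln (x / z)) has_field_derivative 1 / z) (at z)"
      using assms by (auto intro!: derivative_eq_intros)
    show "continuous_on (ball z (norm z)) (\<lambda>x. Ln z + Ln (x / z))"
      using ne assms by (intro continuous_intros) auto
  qed (use assms in auto)
qed

lemma has_partials_descend:
  assumes per: "log_periodic \<kappa> B" and B: "\<And>w. has_partials B (Bu w) (Bv w) w" and z: "z \<noteq> 0"
  shows "has_partials (descend \<kappa> B)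
     (Re (\<kappa> / z) *\<^sub>R descend \<kappa> Bu z + Im (\<kappa> / z) *\<^sub>R descend \<kappa> Bv z)
     (- Im (\<kappa> / z) *\<^sub>R descend \<kappa> Bu z + Re (\<kappa> / z) *\<^sub>R descend \<kappa> Bv z) z"
proof -
  obtain k S where k: "open S" "z \<in> S" "\<And>x. x \<in> S \<Longrightarrow> exp (k x) = x"
    "(k has_field_derivative 1 / z) (at z)" "k z = Ln z"
    using local_log[OF z] by metis
  have "((\<lambda>x. \<kappa> * k x) has_field_derivative \<kappa> / z) (at z)"
    using DERIV_cmult[OF k(4), of \<kappa>] by simp
  from has_partials_holomorphic[OF B[of "\<kappa> * k z"] this] k(5)
  have "has_partials (\<lambda>x. B (\<kappa> * k x))
     (Re (\<kappa> / z) *\<^sub>R descend \<kappa> Bu z + Im (\<kappa> / z) *\<^sub>R descend \<kappa> Bv z)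
     (- Im (\<kappa> / z) *\<^sub>R descend \<kappa> Bu z + Re (\<kappa> / z) *\<^sub>R descend \<kappa> Bv z) z"
    by (simp add: descend_def)
  then show ?thesis
    by (rule has_partials_transform[OF _ k(1,2)]) (use descend_exp[OF per k(3)] in auto)
qed

lemma continuous_descend:
  fixes B :: "complex \<Rightarrow> 'a::topological_space"
  assumes per: "log_periodic \<kappa> B" and B: "continuous_on UNIV B"
  shows "continuous_on (- {0}) (descend \<kappa> B)"
proof -
  have "isCont (descend \<kappa> B) z" if "z \<in> - {0}" for z
  proof -
    have "z \<noteq> 0" using that by simp
    then obtain k S where k: "open S" "z \<in> S" "\<And>x. x \<in> S \<Longrightarrow> exp (k x) = x" "continuous_on S k"
      by (rule local_log) blast
    have "continuous_on S (\<lambda>x. B (\<kappa> * k x))"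
      by (rule continuous_on_compose2[OF B]) (auto intro!: continuous_intros k)
    then have "continuous_on S (descend \<kappa> B)"
      using descend_exp[OF per k(3)] by (simp cong: continuous_on_cong)
    then show ?thesis using k by (simp add: continuous_on_eq_continuous_at)
  qed
  then show ?thesis by (intro continuous_at_imp_continuous_on ballI)
qed

text \<open>Translation by the period does not change \<open>B\<close>, so by uniqueness of
  derivatives it does not change the partials either.\<close>

lemma log_periodic_partials:
  assumes per: "log_periodic \<kappa> B" and B: "\<And>w. has_partials B (Bu w) (Bv w) w"
  shows "log_periodic \<kappa> Bu" "log_periodic \<kappa> Bv"
proof -
  have "Bu (w + \<kappa> * (2 * of_real pi * \<i>)) = Bu w \<and> Bv (w + \<kappa> * (2 * of_real pi * \<i>)) = Bv w" for w
  proof -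
    have "((\<lambda>w. w + \<kappa> * (2 * of_real pi * \<i>)) has_field_derivative 1) (at w)"
      by (auto intro!: derivative_eq_intros)
    from has_partials_holomorphic[OF B this]
    have "has_partials B (Bu (w + \<kappa> * (2 * of_real pi * \<i>))) (Bv (w + \<kappa> * (2 * of_real pi * \<i>))) w"
      using per by (simp add: log_periodic_def)
    with B[of w] show ?thesis using has_partials_unique by blast
  qed
  then show "log_periodic \<kappa> Bu" "log_periodic \<kappa> Bv" by (auto simp: log_periodic_def)
qed

section \<open>Conformality and minimality under a holomorphic change of parameter\<close>

lemma nil_form_linear:
  "nil_form p (a + b) = nil_form p a + nil_form p b" "nil_form p (r *\<^sub>R a) = r * nil_form p a"
  by (simp_all add: nil_form_def field_simps)

lemma nil_metric_rotate:
  assumes "nil_metric p U U = nil_metric p V V" "nil_metric p U V = 0"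
  shows "nil_metric p (a *\<^sub>R U + b *\<^sub>R V) (a *\<^sub>R U + b *\<^sub>R V) = (a^2 + b^2) * nil_metric p U U"
    "nil_metric p (- b *\<^sub>R U + a *\<^sub>R V) (- b *\<^sub>R U + a *\<^sub>R V) = (a^2 + b^2) * nil_metric p U U"
    "nil_metric p (a *\<^sub>R U + b *\<^sub>R V) (- b *\<^sub>R U + a *\<^sub>R V) = 0"
proof -
  let ?f = "nil_form p"
  note expand = nil_metric_def nil_form_linear vector_add_component vector_scaleR_component
  have "U$1 * U$1 + U$2 * U$2 + ?f U * ?f U = V$1 * V$1 + V$2 * V$2 + ?f V * ?f V"
    "U$1 * V$1 + U$2 * V$2 + ?f U * ?f V = 0"
    using assms by (simp_all add: nil_metric_def)
  then show "nil_metric p (a *\<^sub>R U + b *\<^sub>R V) (a *\<^sub>R U + b *\<^sub>R V) = (a^2 + b^2) * nil_metric p U U"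
    "nil_metric p (- b *\<^sub>R U + a *\<^sub>R V) (- b *\<^sub>R U + a *\<^sub>R V) = (a^2 + b^2) * nil_metric p U U"
    "nil_metric p (a *\<^sub>R U + b *\<^sub>R V) (- b *\<^sub>R U + a *\<^sub>R V) = 0"
    unfolding expand real_scaleR_def by - (algebra, algebra, algebra)
qed

text \<open>\<open>nil_accel\<close> is linear in the second derivative, so only the sum
  \<open>W + W'\<close> enters. In the part quadratic in the velocity the mixed terms in
  \<open>U\<close> and \<open>V\<close> cancel between the two summands.\<close>

lemma nil_accel_rotate:
  assumes "W + W' = (a^2 + b^2) *\<^sub>R (P + Q)"
  shows "nil_accel p (a *\<^sub>R U + b *\<^sub>R V) W N + nil_accel p (- b *\<^sub>R U + a *\<^sub>R V) W' N
    = (a^2 + b^2) * (nil_accel p U P N + nil_accel p V Q N)"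
proof -
  have 1: "W $ i + W' $ i = (a^2 + b^2) * (P $ i + Q $ i)" for i
    using arg_cong[OF assms, of "\<lambda>x. x $ i"] by simp
  have 2: "nil_form p W + nil_form p W' = (a^2 + b^2) * (nil_form p P + nil_form p Q)"
    using arg_cong[OF assms, of "nil_form p"] by (simp only: nil_form_linear)
  show ?thesis
    unfolding nil_accel_def nil_form_linear vector_add_component vector_scaleR_component real_scaleR_def
    using 1[of 1] 1[of 2] 2 by algebra
qed

lemma descend_conformal_minimal:
  fixes Y Yu Yv Yuu Yuv Yvv :: "complex \<Rightarrow> real^3"
  assumes \<kappa>: "\<kappa> \<noteq> 0" and per: "log_periodic \<kappa> Y"
    and Y: "\<And>w. has_partials Y (Yu w) (Yv w) w"
    and Yu: "\<And>w. has_partials Yu (Yuu w) (Yuv w) w" and Yv: "\<And>w. has_partials Yv (Yuv w) (Yvv w) w"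
    and cont: "continuous_on UNIV Yuu" "continuous_on UNIV Yuv" "continuous_on UNIV Yvv"
    and pos: "\<And>w. nil_metric (Y w) (Yu w) (Yu w) > 0"
    and conf: "\<And>w. nil_metric (Y w) (Yu w) (Yu w) = nil_metric (Y w) (Yv w) (Yv w)"
    and orth: "\<And>w. nil_metric (Y w) (Yu w) (Yv w) = 0"
    and accel: "\<And>w N. nil_accel (Y w) (Yu w) (Yuu w) N + nil_accel (Y w) (Yv w) (Yvv w) N = 0"
  shows "nil_conformal_immersion (- {0}) (descend \<kappa> Y)" "nil_minimal (- {0}) (descend \<kappa> Y)"
proof -
  define F where "F = descend \<kappa> Y"
  define Fu where "Fu = descend \<kappa> Yu"
  define Fv where "Fv = descend \<kappa> Yv"
  define Fuu where "Fuu = descend \<kappa> Yuu"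
  define Fuv where "Fuv = descend \<kappa> Yuv"
  define Fvv where "Fvv = descend \<kappa> Yvv"
  define a where "a z = Re (\<kappa> / z)" for z
  define b where "b z = Im (\<kappa> / z)" for z
  \<comment> \<open>\<open>a + \<i> b\<close> is the derivative \<open>\<kappa> / z\<close> of the
    inverse parameter, and \<open>m + \<i> n\<close> is its second derivative.\<close>
  define m where "m z = Re (- \<kappa> / z^2)" for z
  define n where "n z = Im (- \<kappa> / z^2)" for z
  note per1 = log_periodic_partials[OF per Y]
  note per2 = log_periodic_partials[OF per1(1) Yu] log_periodic_partials(2)[OF per1(2) Yv]
  have dF: "has_partials F (a z *\<^sub>R Fu z + b z *\<^sub>R Fv z) (- b z *\<^sub>R Fu z + a z *\<^sub>R Fv z) z"
    if "z \<noteq> 0" for z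
    unfolding F_def Fu_def Fv_def a_def b_def by (rule has_partials_descend[OF per Y that])
  have dFu: "has_partials Fu (a z *\<^sub>R Fuu z + b z *\<^sub>R Fuv z) (- b z *\<^sub>R Fuu z + a z *\<^sub>R Fuv z) z"
    if "z \<noteq> 0" for z
    unfolding Fu_def Fuu_def Fuv_def a_def b_def by (rule has_partials_descend[OF per1(1) Yu that])
  have dFv: "has_partials Fv (a z *\<^sub>R Fuv z + b z *\<^sub>R Fvv z) (- b z *\<^sub>R Fuv z + a z *\<^sub>R Fvv z) z"
    if "z \<noteq> 0" for z
    unfolding Fv_def Fuv_def Fvv_def a_def b_def by (rule has_partials_descend[OF per1(2) Yv that])
  have "((\<lambda>z. \<kappa> / z) has_field_derivative - \<kappa> / z^2) (at z)" if "z \<noteq> 0" for z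
    using that by (auto intro!: derivative_eq_intros simp: power2_eq_square)
  then have da: "has_partials a (m z) (- n z) z" and db: "has_partials b (n z) (m z) z" if "z \<noteq> 0" for z
    using that has_partials_Re_holomorphic has_partials_Im_holomorphic
    unfolding a_def[abs_def] b_def[abs_def] m_def n_def by blast+
  have D1F: "D1 F z = a z *\<^sub>R Fu z + b z *\<^sub>R Fv z" and D2F: "D2 F z = - b z *\<^sub>R Fu z + a z *\<^sub>R Fv z"
    if "z \<noteq> 0" for z
    using D1_eq[OF dF[OF that]] D2_eq[OF dF[OF that]] by auto
  define F11 where "F11 z = m z *\<^sub>R Fu z + a z *\<^sub>R (a z *\<^sub>R Fuu z + b z *\<^sub>R Fuv z)
     + (n z *\<^sub>R Fv z + b z *\<^sub>R (a z *\<^sub>R Fuv z + b z *\<^sub>R Fvv z))" for z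
  define F12 where "F12 z = - n z *\<^sub>R Fu z + a z *\<^sub>R (- b z *\<^sub>R Fuu z + a z *\<^sub>R Fuv z)
     + (m z *\<^sub>R Fv z + b z *\<^sub>R (- b z *\<^sub>R Fuv z + a z *\<^sub>R Fvv z))" for z
  define F21 where "F21 z = - n z *\<^sub>R Fu z + - b z *\<^sub>R (a z *\<^sub>R Fuu z + b z *\<^sub>R Fuv z)
     + (m z *\<^sub>R Fv z + a z *\<^sub>R (a z *\<^sub>R Fuv z + b z *\<^sub>R Fvv z))" for z
  define F22 where "F22 z = - m z *\<^sub>R Fu z + - b z *\<^sub>R (- b z *\<^sub>R Fuu z + a z *\<^sub>R Fuv z)
     + (- n z *\<^sub>R Fv z + a z *\<^sub>R (- b z *\<^sub>R Fuv z + a z *\<^sub>R Fvv z))" for z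
  have dD1F: "has_partials (D1 F) (F11 z) (F12 z) z" if "z \<noteq> 0" for z
  proof -
    have "has_partials (\<lambda>z. a z *\<^sub>R Fu z + b z *\<^sub>R Fv z) (F11 z) (F12 z) z"
      unfolding F11_def F12_def
      by (rule has_partials_add[OF has_partials_scaleR[OF da dFu] has_partials_scaleR[OF db dFv]]) (fact that)+
    then show ?thesis
      by (rule has_partials_transform[where S = "- {0}"]) (use that D1F in auto)
  qed
  have dD2F: "has_partials (D2 F) (F21 z) (F22 z) z" if "z \<noteq> 0" for z
  proof -
    have "has_partials (\<lambda>z. - b z *\<^sub>R Fu z + a z *\<^sub>R Fv z) (F21 z) (F22 z) z"
      unfolding F21_def F22_def
      by (rule has_partials_add[OF has_partials_scaleR[OF has_partials_uminus[OF db] dFu] has_partials_scaleR[OF da dFv]])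
        (fact that)+
    then show ?thesis
      by (rule has_partials_transform[where S = "- {0}"]) (use that D2F in auto)
  qed
  have c1: "continuous_on (- {0}) f" if "\<And>z. z \<noteq> 0 \<Longrightarrow> has_partials f (p z) (q z) z"
    for f :: "complex \<Rightarrow> real^3" and p q
    using that by (intro continuous_at_imp_continuous_on ballI) (auto intro: has_partials_isCont)
  have c2: "continuous_on (- {0}) f" if "\<And>z. z \<noteq> 0 \<Longrightarrow> has_partials f (p z) (q z) z"
    for f :: "complex \<Rightarrow> real" and p q
    using that by (intro continuous_at_imp_continuous_on ballI) (auto intro: has_partials_isCont)
  have cmn: "continuous_on (- {0}) m" "continuous_on (- {0}) n"
    unfolding m_def[abs_def] n_def[abs_def] by (intro continuous_intros; simp)+
  note c = c1[OF dFu] c1[OF dFv] c2[OF da] c2[OF db] cmn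
    continuous_descend[OF per2(1) cont(1), folded Fuu_def]
    continuous_descend[OF per2(2) cont(2), folded Fuv_def]
    continuous_descend[OF per2(3) cont(3), folded Fvv_def]
  have cF: "continuous_on (- {0}) F11" "continuous_on (- {0}) F12" "continuous_on (- {0}) F21" "continuous_on (- {0}) F22"
    unfolding F11_def[abs_def] F12_def[abs_def] F21_def[abs_def] F22_def[abs_def]
    by (auto intro!: continuous_on_scaleR continuous_on_add continuous_on_diff continuous_on_minus c)
  have C2: "C2_on (- {0}) F"
    unfolding C2_on_def
  proof (intro conjI ballI)
    fix z :: complex assume "z \<in> - {0}"
    then show "F differentiable (at z)" "D1 F differentiable (at z)" "D2 F differentiable (at z)"
      using has_partials_differentiable[OF dF] has_partials_differentiable[OF dD1F]
        has_partials_differentiable[OF dD2F] by auto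
  next
    show "continuous_on (- {0}) (D1 (D1 F))" "continuous_on (- {0}) (D2 (D1 F))"
      "continuous_on (- {0}) (D1 (D2 F))" "continuous_on (- {0}) (D2 (D2 F))"
      by (rule continuous_on_eq[OF cF(1)], simp add: D1_eq[OF dD1F])
        (rule continuous_on_eq[OF cF(2)], simp add: D2_eq[OF dD1F],
         rule continuous_on_eq[OF cF(3)], simp add: D1_eq[OF dD2F],
         rule continuous_on_eq[OF cF(4)], simp add: D2_eq[OF dD2F])
  qed auto
  have met: "nil_metric (F z) (D1 F z) (D1 F z) = ((a z)^2 + (b z)^2) * nil_metric (F z) (Fu z) (Fu z)"
    "nil_metric (F z) (D2 F z) (D2 F z) = ((a z)^2 + (b z)^2) * nil_metric (F z) (Fu z) (Fu z)"
    "nil_metric (F z) (D1 F z) (D2 F z) = 0" if "z \<noteq> 0" for z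
  proof -
    have "nil_metric (F z) (Fu z) (Fu z) = nil_metric (F z) (Fv z) (Fv z)" "nil_metric (F z) (Fu z) (Fv z) = 0"
      using conf orth by (auto simp: F_def Fu_def Fv_def descend_def)
    from nil_metric_rotate[OF this] show "nil_metric (F z) (D1 F z) (D1 F z) = ((a z)^2 + (b z)^2) * nil_metric (F z) (Fu z) (Fu z)"
      "nil_metric (F z) (D2 F z) (D2 F z) = ((a z)^2 + (b z)^2) * nil_metric (F z) (Fu z) (Fu z)"
      "nil_metric (F z) (D1 F z) (D2 F z) = 0"
      unfolding D1F[OF that] D2F[OF that] by blast+
  qed
  have "(a z)^2 + (b z)^2 > 0" if "z \<noteq> 0" for z
  proof -
    have "(a z)^2 + (b z)^2 = (norm (\<kappa> / z))^2" by (simp add: a_def b_def cmod_power2)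
    also have "\<dots> > 0" using that \<kappa> by simp
    finally show ?thesis .
  qed
  then have "nil_metric (F z) (D1 F z) (D1 F z) > 0" if "z \<noteq> 0" for z
    unfolding met(1)[OF that] using that pos by (simp add: F_def Fu_def descend_def)
  then show "nil_conformal_immersion (- {0}) (descend \<kappa> Y)"
    unfolding nil_conformal_immersion_def F_def[symmetric] using C2 met by auto
  show "nil_minimal (- {0}) (descend \<kappa> Y)"
    unfolding nil_minimal_def F_def[symmetric]
  proof (intro ballI allI impI)
    fix z :: complex and N :: "real^3" assume "z \<in> - {0}"
    then have z: "z \<noteq> 0" by simp
    \<comment> \<open>Conformal invariance of the Laplacian: the terms with \<open>m\<close> and
      \<open>n\<close>, from the second derivative of the parameter change, cancel.\<close>
    have "F11 z + F22 z = ((a z)^2 + (b z)^2) *\<^sub>R (Fuu z + Fvv z)"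
      by (simp add: F11_def F22_def algebra_simps power2_eq_square)
    from nil_accel_rotate[OF this]
    have "nil_accel (F z) (D1 F z) (D1 (D1 F) z) N + nil_accel (F z) (D2 F z) (D2 (D2 F) z) N = 0"
      unfolding D1F[OF z] D2F[OF z] D1_eq[OF dD1F[OF z]] D2_eq[OF dD2F[OF z]]
      using accel by (simp add: F_def Fu_def Fv_def Fuu_def Fvv_def descend_def)
    then show "(\<Sum>l\<in>UNIV. nil_mean_curv_low F z l * N $ l) = 0"
      using met[OF z] by (intro nil_minimal_conformal) auto
  qed
qed

subsection \<open>The parametrization of the catenoid\<close>

text \<open>The profile data in polynomial form, free of roots and choice operators.
  \<open>b\<close> is the increment of \<open>\<beta>\<close> over half a period; the increment of
  \<open>G\<close> expresses the period condition \<open>L = 0\<close>.\<close>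

locale nil_catenoid =
  fixes \<alpha> C h b :: real and \<phi> g \<beta> G :: "real \<Rightarrow> real"
  assumes \<alpha>: "\<alpha> > 0" and C: "C > 0" and h: "h > 0"
    and \<phi>_deriv: "\<And>u. (\<phi> has_real_derivative (cos (\<phi> u))^2 * g u - \<alpha>) (at u)"
    and \<phi>_neg: "\<And>u. (cos (\<phi> u))^2 * g u < \<alpha>"
    and g_deriv: "\<And>u. (g has_real_derivative ((g u)^2 + C^2) * sin (\<phi> u) * cos (\<phi> u)) (at u)"
    and \<beta>_deriv: "\<And>u. (\<beta> has_real_derivative C * (cos (\<phi> u))^2) (at u)"
    and G_deriv: "\<And>u. (G has_real_derivative g u) (at u)"
    and \<phi>_half: "\<And>u. \<phi> (u + h) = \<phi> u - pi" and g_half: "\<And>u. g (u + h) = g u"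
    and \<beta>_half: "\<And>u. \<beta> (u + h) = \<beta> u + b" and G_half: "\<And>u. G (u + h) = G u - C * b / \<alpha>"
    and \<phi>_odd: "\<And>u. \<phi> (- u) = - \<phi> u" and g_even: "\<And>u. g (- u) = g u"
    and \<beta>_odd: "\<And>u. \<beta> (- u) = - \<beta> u" and G_odd: "\<And>u. G (- u) = - G u"
begin

definition A :: "complex \<Rightarrow> real" where "A w = \<alpha> * Im w + \<beta> (Re w)"

definition X1 :: "complex \<Rightarrow> real" where
  "X1 w = g (Re w) / \<alpha> * cos (\<phi> (Re w)) * sinh (A w) - C / \<alpha> * sin (\<phi> (Re w)) * cosh (A w)"

definition X2 :: "complex \<Rightarrow> real" where "X2 w = C * Im w - G (Re w)"

text \<open>With \<open>q = x\<^sub>3 + x\<^sub>1 x\<^sub>2 / 2\<close> the contact form becomes \<open>dq - x\<^sub>1 dx\<^sub>2\<close>, and \<open>(x\<^sub>1, q)\<close> are the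
  Euclidean coordinates on the vertical planes.\<close>
definition Q :: "complex \<Rightarrow> real" where
  "Q w = C / \<alpha> * (g (Re w) / \<alpha> - 1) * cos (\<phi> (Re w)) * cosh (A w)
     - 1 / \<alpha> * (C^2 / \<alpha> + g (Re w)) * sin (\<phi> (Re w)) * sinh (A w)"

definition Y :: "complex \<Rightarrow> real^3" where
  "Y w = vector [X1 w, X2 w, - (X1 w * X2 w) / 2 + Q w]"

abbreviation "sn w \<equiv> sin (\<phi> (Re w))"
abbreviation "cs w \<equiv> cos (\<phi> (Re w))"
abbreviation "gg w \<equiv> g (Re w)"

section \<open>First and second partial derivatives of the parametrization\<close>

lemma partials_atoms:
  "has_partials (\<lambda>w. gg w) (((gg w)^2 + C^2) * sn w * cs w) 0 w"
  "has_partials (\<lambda>w. sn w) (cs w * ((cs w)^2 * gg w - \<alpha>)) 0 w"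
  "has_partials (\<lambda>w. cs w) (- sn w * ((cs w)^2 * gg w - \<alpha>)) 0 w"
  "has_partials (\<lambda>w. G (Re w)) (gg w) 0 w"
  "has_partials A (C * (cs w)^2) \<alpha> w"
  "has_partials (\<lambda>w. sinh (A w)) (C * (cs w)^2 * cosh (A w)) (\<alpha> * cosh (A w)) w"
  "has_partials (\<lambda>w. cosh (A w)) (C * (cs w)^2 * sinh (A w)) (\<alpha> * sinh (A w)) w"
proof -
  show "has_partials (\<lambda>w. gg w) (((gg w)^2 + C^2) * sn w * cs w) 0 w"
    by (rule has_partials_Re[OF g_deriv])
  show "has_partials (\<lambda>w. G (Re w)) (gg w) 0 w"
    by (rule has_partials_Re[OF G_deriv])
  show "has_partials (\<lambda>w. sn w) (cs w * ((cs w)^2 * gg w - \<alpha>)) 0 w"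
    by (rule has_partials_Re[OF DERIV_chain2[OF DERIV_sin \<phi>_deriv]])
  show "has_partials (\<lambda>w. cs w) (- sn w * ((cs w)^2 * gg w - \<alpha>)) 0 w"
    by (rule has_partials_Re[OF DERIV_chain2[OF DERIV_cos \<phi>_deriv]])
  show A: "has_partials A (C * (cs w)^2) \<alpha> w"
    unfolding A_def[abs_def]
    by (rule has_partials_cong, rule has_partials_add[OF has_partials_mult[OF has_partials_const has_partials_Im]
        has_partials_Re[OF \<beta>_deriv]]) auto
  show "has_partials (\<lambda>w. sinh (A w)) (C * (cs w)^2 * cosh (A w)) (\<alpha> * cosh (A w)) w"
    by (rule has_partials_cong, rule has_partials_chain[OF has_field_derivative_sinh A]) auto
  show "has_partials (\<lambda>w. cosh (A w)) (C * (cs w)^2 * sinh (A w)) (\<alpha> * sinh (A w)) w"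
    by (rule has_partials_cong, rule has_partials_chain[OF has_field_derivative_cosh A]) auto
qed

definition X1u where "X1u w = gg w * sn w * sinh (A w) + C * cs w * cosh (A w)"
definition X1v where "X1v w = gg w * cs w * cosh (A w) - C * sn w * sinh (A w)"

text \<open>The values of the contact form on the two coordinate vector fields.\<close>
definition Eu where "Eu w = gg w * cs w * sinh (A w) - C * sn w * cosh (A w)"
definition Ev where "Ev w = - C * cs w * sinh (A w) - gg w * sn w * cosh (A w)"

lemmas partials_rules = has_partials_diff has_partials_add has_partials_mult has_partials_uminus
  partials_atoms has_partials_const has_partials_Im

lemma trig: "(sn w)^2 + (cs w)^2 = 1" "(cosh (A w))^2 = (sinh (A w))^2 + 1"
  by (simp_all add: cosh_square_eq)

lemma inv_\<alpha>: "\<alpha> * (1 / \<alpha>) = 1" using \<alpha> by simp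

lemmas zero_rules = mult_zero_left mult_zero_right add_0_left add_0_right minus_zero diff_zero diff_0

lemma partials_Eu: "has_partials Eu (\<alpha> * X1u w) (\<alpha> * X1v w) w"
  unfolding Eu_def[abs_def]
  apply (rule has_partials_cong)
    apply (rule partials_rules)+
  subgoal unfolding X1u_def by (simp add: algebra_simps power2_eq_square)
  subgoal unfolding X1v_def by (simp add: algebra_simps)
  done

lemma partials_Ev: "has_partials Ev (\<alpha> * X1v w - gg w * X1v w - C * X1u w) (- \<alpha> * X1u w) w"
  unfolding Ev_def[abs_def]
  apply (rule has_partials_cong)
    apply (rule partials_rules)+
  subgoal unfolding X1u_def X1v_def by ((simp add: algebra_simps power2_eq_square; fail) | ((simp only: zero_rules)?, insert trig[of w], algebra))
  subgoal unfolding X1u_def by ((simp add: algebra_simps power2_eq_square; fail) | ((simp only: zero_rules)?, insert trig[of w], algebra))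
  done

lemma X1_eq: "X1 w = 1 / \<alpha> * Eu w"
  by (simp add: X1_def Eu_def diff_divide_distrib)

lemma partials_X1: "has_partials X1 (X1u w) (X1v w) w"
  unfolding X1_eq[abs_def]
  by (rule has_partials_cong, rule has_partials_mult[OF has_partials_const partials_Eu]) (use \<alpha> in auto)

text \<open>Equivalent to saying that \<open>dq - x\<^sub>1 dx\<^sub>2\<close> has the components
  \<open>Eu\<close> and \<open>Ev\<close>, because \<open>x\<^sub>2\<close> has the partials
  \<open>- g\<close> and \<open>C\<close>.\<close>

lemma partials_Q: "has_partials Q (Eu w - gg w * X1 w) (Ev w + C * X1 w) w"
proof -
  \<comment> \<open>Naming the reciprocal turns the claim into a polynomial identity modulo
    \<open>\<alpha> * r = 1\<close>, which \<open>algebra\<close> can decide.\<close>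
  define r where "r = 1 / \<alpha>"
  have r: "\<alpha> * r = 1" using inv_\<alpha> by (simp add: r_def)
  have Q: "Q = (\<lambda>w. r * (C * (gg w * r - 1) * cs w * cosh (A w) - (C * C * r + gg w) * sn w * sinh (A w)))"
    by (simp add: Q_def fun_eq_iff r_def power2_eq_square diff_divide_distrib)
  show ?thesis
    unfolding Q X1_eq r_def[symmetric] Eu_def Ev_def
    apply (rule has_partials_cong)
      apply (rule partials_rules)+
    subgoal by ((simp add: algebra_simps power2_eq_square; fail) | ((simp only: zero_rules)?, insert trig[of w] r, algebra))
    subgoal by ((simp add: algebra_simps power2_eq_square; fail) | ((simp only: zero_rules)?, insert trig[of w] r, algebra))
    done
qed

text \<open>Written so that adding the second \<open>v\<close>-derivative
  \<open>\<alpha> * Eu\<close> leaves \<open>gg * Eu - C * Ev\<close>, the first component of the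
  harmonic map equation.\<close>

definition X1uu where "X1uu w = gg w * Eu w - C * Ev w - \<alpha> * Eu w"
definition X1uv where "X1uv w = \<alpha> * (gg w * sn w * cosh (A w) + C * cs w * sinh (A w))"
definition gu where "gu w = ((gg w)^2 + C^2) * sn w * cs w"

lemma partials_X1u: "has_partials X1u (X1uu w) (X1uv w) w"
  unfolding X1u_def[abs_def] X1uu_def X1uv_def Eu_def Ev_def
  apply (rule has_partials_cong)
    apply (rule partials_rules)+
  subgoal by ((simp add: algebra_simps power2_eq_square; fail) | ((simp only: zero_rules)?, insert trig[of w], algebra))
  subgoal by ((simp add: algebra_simps power2_eq_square; fail) | ((simp only: zero_rules)?, insert trig[of w], algebra))
  done

lemma partials_X1v: "has_partials X1v (X1uv w) (\<alpha> * Eu w) w"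
  unfolding X1v_def[abs_def] X1uv_def Eu_def
  apply (rule has_partials_cong)
    apply (rule partials_rules)+
  subgoal by ((simp add: algebra_simps power2_eq_square; fail) | ((simp only: zero_rules)?, insert trig[of w], algebra))
  subgoal by ((simp add: algebra_simps power2_eq_square; fail) | ((simp only: zero_rules)?, insert trig[of w], algebra))
  done

lemma partials_gg: "has_partials (\<lambda>w. gg w) (gu w) 0 w"
  unfolding gu_def by (rule partials_atoms)

lemma partials_X2: "has_partials X2 (- gg w) C w"
  unfolding X2_def[abs_def]
  by (rule has_partials_cong, (rule partials_rules)+) auto

definition Yu :: "complex \<Rightarrow> real^3" where
  "Yu w = vector [X1u w, - gg w, - (1/2 * (X1u w * X2 w - X1 w * gg w)) + (Eu w - gg w * X1 w)]"

definition Yv :: "complex \<Rightarrow> real^3" where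
  "Yv w = vector [X1v w, C, - (1/2 * (X1v w * X2 w + X1 w * C)) + (Ev w + C * X1 w)]"

definition Yuu :: "complex \<Rightarrow> real^3" where
  "Yuu w = vector [X1uu w, - gu w,
     - (1/2 * (X1uu w * X2 w - 2 * X1u w * gg w - X1 w * gu w)) + (\<alpha> * X1u w - gu w * X1 w - gg w * X1u w)]"

definition Yuv :: "complex \<Rightarrow> real^3" where
  "Yuv w = vector [X1uv w, 0,
     - (1/2 * (X1uv w * X2 w + X1u w * C - X1v w * gg w)) + (\<alpha> * X1v w - gg w * X1v w)]"

definition Yvv :: "complex \<Rightarrow> real^3" where
  "Yvv w = vector [\<alpha> * Eu w, 0,
     - (1/2 * (\<alpha> * Eu w * X2 w + 2 * X1v w * C)) + (- \<alpha> * X1u w + C * X1v w)]"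

lemmas partials_rules2 = has_partials_diff has_partials_add has_partials_mult has_partials_uminus
  partials_X1 partials_X2 partials_Q partials_Eu partials_Ev partials_X1u partials_X1v partials_gg
  has_partials_const

lemma Y_eq: "Y w = vector [X1 w, X2 w, - (1/2 * (X1 w * X2 w)) + Q w]"
  by (simp add: Y_def)

lemma partials_Y: "has_partials Y (Yu w) (Yv w) w"
  unfolding Y_eq[abs_def] Yu_def Yv_def
  apply (rule has_partials_vector)
    apply (rule partials_X1)
   apply (rule partials_X2)
  apply (rule has_partials_cong)
    apply (rule partials_rules2)+
   apply (simp_all add: algebra_simps)
  done

lemma partials_Yu: "has_partials Yu (Yuu w) (Yuv w) w"
  unfolding Yu_def[abs_def] Yuu_def Yuv_def
  apply (rule has_partials_vector)
    apply (rule partials_X1u)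
   apply (rule has_partials_cong)
     apply (rule partials_rules2)+
    apply simp
   apply simp
  apply (rule has_partials_cong)
    apply (rule partials_rules2)+
   apply (simp_all add: algebra_simps)
  done

lemma partials_Yv: "has_partials Yv (Yuv w) (Yvv w) w"
  unfolding Yv_def[abs_def] Yuv_def Yvv_def
  apply (rule has_partials_vector)
    apply (rule partials_X1v)
   apply (rule has_partials_const)
  apply (rule has_partials_cong)
    apply (rule partials_rules2)+
   apply (simp_all add: algebra_simps)
  done

section \<open>Conformality and harmonicity of the parametrization\<close>

lemma nil_form_Yu: "nil_form (Y w) (Yu w) = Eu w" and nil_form_Yv: "nil_form (Y w) (Yv w) = Ev w"
  by (simp_all add: nil_form_def Y_def Yu_def Yv_def field_simps)

lemma metric_Y:
  "nil_metric (Y w) (Yu w) (Yu w) = ((gg w)^2 + C^2) * (cosh (A w))^2"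
  "nil_metric (Y w) (Yv w) (Yv w) = ((gg w)^2 + C^2) * (cosh (A w))^2"
  "nil_metric (Y w) (Yu w) (Yv w) = 0"
proof -
  note e = nil_metric_def nil_form_Yu nil_form_Yv Yu_def Yv_def vector_3 X1u_def X1v_def Eu_def Ev_def
  show "nil_metric (Y w) (Yu w) (Yu w) = ((gg w)^2 + C^2) * (cosh (A w))^2"
    unfolding nil_metric_def nil_form_Yu unfolding e using trig[of w] by algebra
  show "nil_metric (Y w) (Yv w) (Yv w) = ((gg w)^2 + C^2) * (cosh (A w))^2"
    unfolding nil_metric_def nil_form_Yv unfolding e using trig[of w] by algebra
  show "nil_metric (Y w) (Yu w) (Yv w) = 0"
    unfolding nil_metric_def nil_form_Yu nil_form_Yv unfolding e using trig[of w] by algebra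
qed

text \<open>In the coframe \<open>dx\<^sub>1\<close>, \<open>dx\<^sub>2\<close>, contact form, the
  coefficients of \<open>N$1\<close>, \<open>N$2\<close> and \<open>nil_form (Y w) N\<close> vanish
  separately: by the form of \<open>X1uu\<close>, by the equation for \<open>g'\<close>, and because
  the contact components are divergence free.\<close>

lemma accel_Y: "nil_accel (Y w) (Yu w) (Yuu w) N + nil_accel (Y w) (Yv w) (Yvv w) N = 0"
proof -
  have 1: "nil_form (Y w) (Yuu w) + nil_form (Y w) (Yvv w) = 0"
    by (simp add: nil_form_def Y_def Yuu_def Yvv_def X1uu_def field_simps)
  have 2: "Eu w * X1u w + Ev w * X1v w = - gu w"
    unfolding Eu_def Ev_def X1u_def X1v_def gu_def using trig[of w] by algebra
  have "nil_accel (Y w) (Yu w) (Yuu w) N + nil_accel (Y w) (Yv w) (Yvv w) N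
    = (X1uu w + \<alpha> * Eu w - gg w * Eu w + C * Ev w) * N$1 - (gu w + (Eu w * X1u w + Ev w * X1v w)) * N$2
      + (nil_form (Y w) (Yuu w) + nil_form (Y w) (Yvv w)) * nil_form (Y w) N"
    unfolding nil_accel_def nil_form_Yu nil_form_Yv
    by (simp add: Yu_def Yv_def Yuu_def Yvv_def algebra_simps)
  also have "\<dots> = 0" unfolding 1 2 X1uu_def by simp
  finally show ?thesis .
qed

lemma continuous_atoms:
  "continuous_on UNIV X1" "continuous_on UNIV X2" "continuous_on UNIV Eu" "continuous_on UNIV Ev"
  "continuous_on UNIV X1u" "continuous_on UNIV X1v" "continuous_on UNIV (\<lambda>w. gg w)"
  "continuous_on UNIV (\<lambda>w. sn w)" "continuous_on UNIV (\<lambda>w. cs w)" "continuous_on UNIV A"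
  "continuous_on UNIV Q"
  using has_partials_isCont[OF partials_X1] has_partials_isCont[OF partials_X2]
    has_partials_isCont[OF partials_Eu] has_partials_isCont[OF partials_Ev]
    has_partials_isCont[OF partials_X1u] has_partials_isCont[OF partials_X1v]
    has_partials_isCont[OF partials_gg] has_partials_isCont[OF partials_Q]
    has_partials_isCont[OF partials_atoms(2)] has_partials_isCont[OF partials_atoms(3)]
    has_partials_isCont[OF partials_atoms(5)]
  by (simp_all add: continuous_at_imp_continuous_on)

lemma continuous_second: "continuous_on UNIV Yuu" "continuous_on UNIV Yuv" "continuous_on UNIV Yvv"
proof -
  have gu: "continuous_on UNIV gu"
    unfolding gu_def[abs_def] by (intro continuous_intros continuous_atoms)
  have X1uu: "continuous_on UNIV X1uu"
    unfolding X1uu_def[abs_def] by (intro continuous_intros continuous_atoms)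
  have X1uv: "continuous_on UNIV X1uv"
    unfolding X1uv_def[abs_def] cosh_field_def sinh_field_def by (intro continuous_intros continuous_atoms) auto
  show "continuous_on UNIV Yuu" "continuous_on UNIV Yuv" "continuous_on UNIV Yvv"
    unfolding Yuu_def[abs_def] Yuv_def[abs_def] Yvv_def[abs_def] vector_3_eq_axis
    by (intro continuous_intros continuous_atoms gu X1uu X1uv)+
qed

end

text \<open>A convergent sequence together with its limit is compact, so its preimage
  \<open>P\<close> is compact; the compact image of the part of \<open>P\<close> in \<open>T\<close>
  contains the whole sequence, hence its limit.\<close>

lemma proper_map_on_closed_image:
  assumes cont: "continuous_on U F" and pr: "proper_map_on U F" and T: "closedin (top_of_set U) T"
  shows "closed (F ` T)"
  unfolding closed_sequential_limits
proof (intro allI impI)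
  fix x :: "nat \<Rightarrow> real^3" and l assume "(\<forall>n. x n \<in> F ` T) \<and> x \<longlonglongrightarrow> l"
  then have x: "\<And>n. x n \<in> F ` T" "x \<longlonglongrightarrow> l" by auto
  obtain T' where T': "closed T'" "T = U \<inter> T'" using T by (auto simp: closedin_closed)
  define P where "P = {z \<in> U. F z \<in> insert l (range x)}"
  have "compact P"
    using pr compact_sequence_with_limit[OF x(2)] unfolding proper_map_on_def P_def by blast
  then have "compact (P \<inter> T')" using T'(1) by (rule compact_Int_closed)
  then have "compact (F ` (P \<inter> T'))"
    by (rule compact_continuous_image[rotated]) (rule continuous_on_subset[OF cont], auto simp: P_def)
  then have cl: "closed (F ` (P \<inter> T'))" by (rule compact_imp_closed)
  have "x n \<in> F ` (P \<inter> T')" for n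
  proof -
    obtain z where z: "z \<in> T" "x n = F z" using x(1)[of n] by auto
    have "F z \<in> range x" unfolding z(2)[symmetric] by simp
    then have "z \<in> P \<inter> T'" using z(1) by (simp add: P_def T'(2))
    then show ?thesis using z(2) by simp
  qed
  then have "l \<in> F ` (P \<inter> T')" using closed_sequentially[OF cl _ x(2)] by blast
  then show "l \<in> F ` T" by (auto simp: P_def T'(2))
qed

lemma proper_injective_homeomorphism:
  assumes cont: "continuous_on U F" and pr: "proper_map_on U F" and inj: "inj_on F U"
  shows "\<exists>H. homeomorphism U (F ` U) F H"
proof -
  have "closedin (top_of_set (F ` U)) (F ` T)" if "closedin (top_of_set U) T" for T
    using proper_map_on_closed_image[OF cont pr that] closedin_imp_subset[OF that]
    by (intro closed_subset image_mono)
  then show ?thesis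
    using homeomorphism_injective_closed_map[OF cont refl inj] by metis
qed

lemma has_partials_compose_curve:
  assumes "has_partials f p q (k u)" "(k has_vector_derivative d) (at u)"
  shows "((\<lambda>u. f (k u)) has_vector_derivative (Re d *\<^sub>R p + Im d *\<^sub>R q)) (at u)"
  using has_derivative_compose[OF assms(2)[unfolded has_vector_derivative_def] assms(1)[unfolded has_partials_def]]
  by (simp add: has_vector_derivative_def algebra_simps)

section \<open>Period, sections, embeddedness, properness and symmetries\<close>

context nil_catenoid
begin

text \<open>The imaginary part offsets the increment \<open>b\<close> of \<open>\<beta>\<close> in
  \<open>A\<close>. The next constant is chosen so that \<open>exp (w / \<kappa>)\<close> has period
  \<open>2 * half\<close>.\<close>

definition half :: complex where "half = Complex h (- b / \<alpha>)"
definition \<kappa> :: complex where "\<kappa> = 2 * half / (2 * of_real pi * \<i>)"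

lemma \<kappa>_period: "\<kappa> * (2 * of_real pi * \<i>) = 2 * half"
proof -
  have "2 * complex_of_real pi * \<i> \<noteq> 0" by simp
  then show ?thesis by (rule nonzero_eq_divide_eq[THEN iffD1]) (rule \<kappa>_def)
qed

lemma \<kappa>_multiple: "\<kappa> * (2 * of_int n * of_real pi * \<i>) = of_int n * (2 * half)"
  unfolding \<kappa>_period[symmetric] by (simp only: mult_ac)

lemma half_ne: "half \<noteq> 0" using h by (auto simp: half_def complex_eq_iff)

lemma \<kappa>_ne: "\<kappa> \<noteq> 0"
  using half_ne \<kappa>_period by auto

lemma A_half: "A (w + half) = A w"
  using \<alpha> \<beta>_half[of "Re w"] by (simp add: A_def half_def right_diff_distrib)

text \<open>\<open>X1\<close> and \<open>Q\<close> are linear in the sine and cosine of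
  \<open>\<phi>\<close>, which change sign, with coefficients in \<open>g\<close> and
  \<open>A\<close>, which do not. That \<open>X2\<close> is fixed as well is the period
  condition.\<close>

lemma Y_half: "X1 (w + half) = - X1 w" "X2 (w + half) = X2 w" "Q (w + half) = - Q w"
proof -
  have r: "Re (w + half) = Re w + h" by (simp add: half_def)
  show "X1 (w + half) = - X1 w" "Q (w + half) = - Q w"
    unfolding X1_def Q_def A_half r \<phi>_half g_half by (simp_all add: algebra_simps)
  show "X2 (w + half) = X2 w"
    using \<alpha> by (simp add: X2_def r G_half half_def right_diff_distrib)
qed

lemma log_periodic_Y: "log_periodic \<kappa> Y"
proof -
  have "Y (w + (half + half)) = Y w" for w by (simp only: add.assoc[symmetric] Y_def Y_half) simp
  then show ?thesis unfolding log_periodic_def \<kappa>_period by (simp only: mult_2 simp_thms)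
qed

lemma log_periodic_X2: "log_periodic \<kappa> X2"
proof -
  have "X2 (w + (half + half)) = X2 w" for w by (simp only: add.assoc[symmetric] Y_half)
  then show ?thesis unfolding log_periodic_def \<kappa>_period by (simp only: mult_2 simp_thms)
qed

lemma descend_image: "descend \<kappa> Y ` (- {0}) = range Y"
proof -
  have "Y w \<in> descend \<kappa> Y ` (- {0})" for w
  proof -
    have "descend \<kappa> Y (exp (w / \<kappa>)) = Y w"
      using descend_exp[OF log_periodic_Y refl, of "w / \<kappa>"] \<kappa>_ne by simp
    then show ?thesis by (metis ComplI exp_not_eq_zero image_eqI singletonD)
  qed
  then show ?thesis by (auto simp: descend_def)
qed

text \<open>The equation \<open>X2 = c\<close> solved for \<open>v\<close>: each level set of
  \<open>X2\<close> is a graph over the \<open>u\<close>-axis.\<close>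

definition sec :: "real \<Rightarrow> real \<Rightarrow> complex" where "sec c u = Complex u ((c + G u) / C)"

definition \<gamma> :: "real \<Rightarrow> real \<Rightarrow> real \<times> real" where "\<gamma> c u = (X1 (sec c u), Q (sec c u))"

lemma X2_sec: "X2 (sec c u) = c" using C by (simp add: X2_def sec_def)

lemma sec_X2: "sec (X2 w) (Re w) = w" using C by (simp add: X2_def sec_def complex_eq_iff)

text \<open>Along the level set \<open>v' = g / C\<close>, and with this slope the terms in
  \<open>sinh A\<close> cancel from both components.\<close>

lemma \<gamma>_deriv: "(\<gamma> c has_vector_derivative
    (((g u)^2 + C^2) * cosh (A (sec c u)) / C) *\<^sub>R (cos (- \<phi> u), sin (- \<phi> u))) (at u)"
proof -
  let ?w = "sec c u"
  have re: "Re ?w = u" by (simp add: sec_def)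
  have s: "(sec c has_vector_derivative Complex 1 (g u / C)) (at u)"
    unfolding sec_def[abs_def] Complex_eq
    using G_deriv[of u] C
    by (auto intro!: derivative_eq_intros simp: has_real_derivative_iff_has_vector_derivative[symmetric])
  have 1: "((\<lambda>u. X1 (sec c u)) has_vector_derivative X1u ?w + g u / C * X1v ?w) (at u)"
    using has_partials_compose_curve[OF partials_X1 s] by simp
  have 2: "((\<lambda>u. Q (sec c u)) has_vector_derivative (Eu ?w - gg ?w * X1 ?w) + g u / C * (Ev ?w + C * X1 ?w)) (at u)"
    using has_partials_compose_curve[OF partials_Q s] by simp
  have e1: "X1u ?w + g u / C * X1v ?w = ((g u)^2 + C^2) * cosh (A ?w) / C * cos (- \<phi> u)"
    using C by (simp add: X1u_def X1v_def re field_simps power2_eq_square)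
  have e2: "(Eu ?w - gg ?w * X1 ?w) + g u / C * (Ev ?w + C * X1 ?w) = ((g u)^2 + C^2) * cosh (A ?w) / C * sin (- \<phi> u)"
    using C by (simp add: Eu_def Ev_def re field_simps power2_eq_square)
  show ?thesis
    unfolding \<gamma>_def[abs_def]
    using has_vector_derivative_Pair[OF 1 2] unfolding e1 e2 by simp
qed

lemma turning: "turning_curve (\<gamma> c) (\<lambda>u. ((g u)^2 + C^2) * cosh (A (sec c u)) / C) (\<lambda>u. - \<phi> u) h"
proof
  show "\<gamma> c (u + h) = - \<gamma> c u" for u
  proof -
    have "sec c (u + h) = sec c u + half"
      using C \<alpha> by (simp add: sec_def half_def complex_eq_iff G_half diff_divide_distrib add_divide_distrib)
    then show ?thesis by (simp add: \<gamma>_def Y_half)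
  qed
  show "continuous_on UNIV (\<lambda>u. - \<phi> u)"
    using DERIV_isCont[OF \<phi>_deriv] by (intro continuous_intros continuous_at_imp_continuous_on ballI)
  show "strict_mono (\<lambda>u. - \<phi> u)"
  proof (rule strict_monoI)
    fix x y :: real assume "x < y"
    then have "\<phi> y < \<phi> x"
    proof (rule DERIV_neg_imp_decreasing)
      fix u show "\<exists>d. (\<phi> has_real_derivative d) (at u) \<and> d < 0"
        using \<phi>_deriv[of u] \<phi>_neg[of u] by (intro exI[of _ "(cos (\<phi> u))\<^sup>2 * g u - \<alpha>"]) auto
    qed
    then show "- \<phi> x < - \<phi> y" by simp
  qed
  show "0 < ((g u)^2 + C^2) * cosh (A (sec c u)) / C" for u
    using C by (intro divide_pos_pos mult_pos_pos add_nonneg_pos cosh_real_pos) auto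
qed (use h \<gamma>_deriv \<phi>_half in auto)

lemma vslice_eq: "vslice c (range Y) = range (\<gamma> c)"
proof -
  have pc: "plane_coords c (Y w) = (X1 w, Q w)" if "X2 w = c" for w
    using that by (simp add: plane_coords_def Y_def algebra_simps)
  have Y2: "Y w $ 2 = X2 w" for w by (simp add: Y_def)
  show ?thesis
  proof (intro equalityI subsetI)
    fix x assume "x \<in> vslice c (range Y)"
    then obtain w where w: "x = plane_coords c (Y w)" "X2 w = c" by (auto simp: vslice_def Y2)
    then have "x = \<gamma> c (Re w)" using pc[OF w(2)] sec_X2[of w] by (simp add: \<gamma>_def)
    then show "x \<in> range (\<gamma> c)" by simp
  next
    fix x assume "x \<in> range (\<gamma> c)"
    then obtain u where "x = \<gamma> c u" by blast
    then have x: "x = plane_coords c (Y (sec c u))" by (simp add: \<gamma>_def pc[OF X2_sec])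
    have "Y (sec c u) \<in> range Y \<inter> {p. p $ 2 = c}"
      using Y2[of "sec c u"] X2_sec[of c u] by simp
    with x show "x \<in> vslice c (range Y)" unfolding vslice_def by (rule image_eqI)
  qed
qed

text \<open>Equal points lie in the same section, where equality determines \<open>Re w\<close> up
  to multiples of \<open>2 * h\<close>. Together with \<open>X2\<close>, which the period preserves,
  the real part determines \<open>w\<close>.\<close>

lemma Y_eq_imp:
  assumes "Y w1 = Y w2"
  obtains n :: int where "w1 = w2 + \<kappa> * (2 * of_int n * of_real pi * \<i>)"
proof -
  have X12: "X1 w1 = X1 w2" "X2 w1 = X2 w2"
    using arg_cong[OF assms, of "\<lambda>p. p $ 1"] arg_cong[OF assms, of "\<lambda>p. p $ 2"] by (simp_all add: Y_def)
  have "Q w1 = Q w2"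
    using arg_cong[OF assms, of "\<lambda>p. p $ 3"] X12 by (simp add: Y_def)
  then have "\<gamma> (X2 w1) (Re w1) = \<gamma> (X2 w1) (Re w2)"
    unfolding \<gamma>_def sec_X2 unfolding X12(2) sec_X2 using X12 by simp
  then obtain n :: int where n: "Re w1 = Re w2 + of_int n * (2 * h)"
    by (rule turning_curve.eq_imp_period[OF turning])
  define w3 where "w3 = w2 + \<kappa> * (2 * of_int n * of_real pi * \<i>)"
  have "w3 = w2 + of_int n * (2 * half)"
    unfolding w3_def \<kappa>_multiple ..
  then have "Re w3 = Re w1" by (simp add: n half_def)
  moreover have "X2 w3 = X2 w1"
    unfolding w3_def X12(2) by (rule log_periodic_int[OF log_periodic_X2])
  ultimately have "w1 = w3" using sec_X2[of w1] sec_X2[of w3] by metis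
  then show ?thesis unfolding w3_def by (rule that)
qed

lemma exp_period: "exp (w / \<kappa> + 2 * of_int n * of_real pi * \<i>) = exp (w / \<kappa>)"
  by (rule exp_eq[THEN iffD2], rule exI[of _ n]) (simp add: algebra_simps)

lemma inj_descend: "inj_on (descend \<kappa> Y) (- {0})"
proof (rule inj_onI)
  fix z1 z2 :: complex assume z: "z1 \<in> - {0}" "z2 \<in> - {0}" and e: "descend \<kappa> Y z1 = descend \<kappa> Y z2"
  obtain n :: int where "\<kappa> * Ln z1 = \<kappa> * Ln z2 + \<kappa> * (2 * of_int n * of_real pi * \<i>)"
    by (rule Y_eq_imp[OF e[unfolded descend_def]])
  then have "\<kappa> * Ln z1 = \<kappa> * (Ln z2 + 2 * of_int n * of_real pi * \<i>)"
    by (simp add: algebra_simps)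
  then have "Ln z1 = Ln z2 + 2 * of_int n * of_real pi * \<i>" using \<kappa>_ne by simp
  then have "exp (Ln z1) = exp (Ln z2)"
    using exp_period[of "\<kappa> * Ln z2" n] \<kappa>_ne by simp
  then show "z1 = z2" using z by simp
qed

lemma proper_descend: "proper_map_on (- {0}) (descend \<kappa> Y)"
  unfolding proper_map_on_def
proof (intro allI impI)
  fix K :: "(real^3) set" assume K: "compact K"
  \<comment> \<open>The strip contains a fundamental domain, since the period has real part
    \<open>2 * h\<close>. So the preimage of \<open>K\<close> is the image of \<open>B\<close> under
    the exponential, and it suffices that \<open>B\<close> is compact.\<close>
  define B where "B = {w. 0 \<le> Re w \<and> Re w \<le> 2 * h \<and> Y w \<in> K}"
  have "closed B"
  proof -
    have "B = {w. 0 \<le> Re w} \<inter> {w. Re w \<le> 2 * h} \<inter> Y -` K" by (auto simp: B_def)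
    moreover have "closed (Y -` K)"
      using continuous_closed_vimage[OF compact_imp_closed[OF K]] has_partials_isCont[OF partials_Y] by blast
    ultimately show ?thesis
      by (auto intro!: closed_Int closed_Collect_le continuous_intros)
  qed
  moreover have "bounded B"
  proof -
    obtain M where M: "\<And>p. p \<in> K \<Longrightarrow> norm p \<le> M"
      using compact_imp_bounded[OF K] by (auto simp: bounded_iff)
    have "continuous_on {0..2 * h} G"
      using DERIV_isCont[OF G_deriv] by (simp add: continuous_at_imp_continuous_on)
    then have "bounded (G ` {0..2 * h})"
      by (intro compact_imp_bounded compact_continuous_image) auto
    then obtain N where "\<forall>x\<in>G ` {0..2 * h}. norm x \<le> N" unfolding bounded_iff by blast
    then have N: "\<bar>G u\<bar> \<le> N" if "0 \<le> u" "u \<le> 2 * h" for u using that by simp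
    have "norm w \<le> 2 * h + (M + N) / C" if "w \<in> B" for w
    proof -
      have "\<bar>X2 w\<bar> \<le> norm (Y w)" using component_le_norm_cart[of "Y w" 2] by (simp add: Y_def)
      then have "\<bar>X2 w\<bar> \<le> M" using M[of "Y w"] that by (simp add: B_def)
      moreover have "\<bar>G (Re w)\<bar> \<le> N" using N that by (simp add: B_def)
      moreover have "Im w = (X2 w + G (Re w)) / C" using C by (simp add: X2_def)
      ultimately have "\<bar>Im w\<bar> \<le> (M + N) / C" using C by (simp add: divide_right_mono)
      moreover have "\<bar>Re w\<bar> \<le> 2 * h" using that by (simp add: B_def)
      ultimately show ?thesis using cmod_le[of w] by linarith
    qed
    then show ?thesis by (auto simp: bounded_iff)
  qed
  ultimately have "compact B" by (simp add: compact_eq_bounded_closed)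
  then have "compact ((\<lambda>w. exp (w / \<kappa>)) ` B)"
    using \<kappa>_ne by (intro compact_continuous_image continuous_intros) auto
  also have "(\<lambda>w. exp (w / \<kappa>)) ` B = {z \<in> - {0}. descend \<kappa> Y z \<in> K}"
  proof (intro equalityI subsetI)
    fix z assume "z \<in> (\<lambda>w. exp (w / \<kappa>)) ` B"
    then show "z \<in> {z \<in> - {0}. descend \<kappa> Y z \<in> K}"
      using descend_exp[OF log_periodic_Y refl] \<kappa>_ne by (auto simp: B_def)
  next
    fix z assume z: "z \<in> {z \<in> - {0}. descend \<kappa> Y z \<in> K}"
    define w where "w = \<kappa> * Ln z"
    obtain n :: int where n: "0 \<le> Re w + of_int n * (2 * h)" "Re w + of_int n * (2 * h) < 0 + 2 * h"
      by (rule turning_curve.reduce_period[OF turning])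
    define w' where "w' = w + \<kappa> * (2 * of_int n * of_real pi * \<i>)"
    have "Re w' = Re w + of_int n * (2 * h)" unfolding w'_def \<kappa>_multiple by (simp add: half_def)
    moreover have "Y w' = Y w"
      unfolding w'_def by (rule log_periodic_int[OF log_periodic_Y])
    then have "Y w' = descend \<kappa> Y z" by (simp add: descend_def w_def)
    ultimately have "w' \<in> B" using n z by (simp add: B_def)
    moreover have "exp (w' / \<kappa>) = z"
    proof -
      have "w' / \<kappa> = w / \<kappa> + 2 * of_int n * of_real pi * \<i>" using \<kappa>_ne by (simp add: w'_def add_divide_distrib)
      then have "exp (w' / \<kappa>) = exp (w / \<kappa>)" using exp_period by simp
      then show ?thesis using z \<kappa>_ne by (simp add: w_def)
    qed
    ultimately show "z \<in> (\<lambda>w. exp (w / \<kappa>)) ` B" by blast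
  qed
  finally show "compact {z \<in> - {0}. descend \<kappa> Y z \<in> K}" .
qed

lemma Y_neg: "X1 (- w) = - X1 w" "X2 (- w) = - X2 w" "Q (- w) = Q w"
proof -
  have "A (- w) = - A w" by (simp add: A_def \<beta>_odd)
  then show "X1 (- w) = - X1 w" "X2 (- w) = - X2 w" "Q (- w) = Q w"
    by (simp_all add: X1_def X2_def Q_def \<phi>_odd g_even G_odd)
qed

lemma image_symmetry:
  assumes "surj k" "\<And>w. f (Y w) = Y (k w)"
  shows "f ` range Y = range Y"
proof -
  have "f ` range Y = Y ` range k" using assms(2) by (auto simp: image_image)
  then show ?thesis using assms(1) by simp
qed

text \<open>Translation by \<open>half\<close> induces the rotation about the
  \<open>x\<^sub>2\<close>-axis, \<open>w \<mapsto> - w\<close> the one about the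
  \<open>x\<^sub>3\<close>-axis, and their composition the one about the
  \<open>x\<^sub>1\<close>-axis.\<close>

lemma Y_rotations:
  "(\<lambda>p. vector [p$1, - p$2, - p$3]) ` range Y = range Y"
  "(\<lambda>p. vector [- p$1, p$2, - p$3]) ` range Y = range Y"
  "(\<lambda>p. vector [- p$1, - p$2, p$3]) ` range Y = range Y"
proof -
  have s1: "surj (\<lambda>w. w + half)" by (rule surjI[of _ "\<lambda>w. w - half"]) simp
  have s2: "surj (\<lambda>w::complex. - w)" by (rule surjI[of _ uminus]) simp
  have s3: "surj (\<lambda>w. - w + half)" by (rule surjI[of _ "\<lambda>w. half - w"]) simp
  show "(\<lambda>p. vector [p$1, - p$2, - p$3]) ` range Y = range Y"
    by (rule image_symmetry[OF s3]) (simp only: Y_def vector_3 Y_half Y_neg, simp)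
  show "(\<lambda>p. vector [- p$1, p$2, - p$3]) ` range Y = range Y"
    by (rule image_symmetry[OF s1]) (simp only: Y_def vector_3 Y_half, simp)
  show "(\<lambda>p. vector [- p$1, - p$2, p$3]) ` range Y = range Y"
    by (rule image_symmetry[OF s2]) (simp only: Y_def vector_3 Y_neg, simp)
qed

lemma conformal_minimal:
  "nil_conformal_immersion (- {0}) (descend \<kappa> Y)" "nil_minimal (- {0}) (descend \<kappa> Y)"
proof -
  have "nil_metric (Y w) (Yu w) (Yu w) > 0" for w
    unfolding metric_Y using C by (intro mult_pos_pos add_nonneg_pos zero_less_power) auto
  note * = descend_conformal_minimal[OF \<kappa>_ne log_periodic_Y partials_Y partials_Yu partials_Yv
      continuous_second this _ metric_Y(3) accel_Y]
  show "nil_conformal_immersion (- {0}) (descend \<kappa> Y)" "nil_minimal (- {0}) (descend \<kappa> Y)"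
    by (rule *, simp add: metric_Y)+
qed

theorem annulus:
  "\<exists>F. nil_conformal_immersion (- {0}) F \<and> nil_minimal (- {0}) F \<and> F ` (- {0}) = range Y \<and>
     (\<exists>H. homeomorphism (- {0}) (range Y) F H) \<and> proper_map_on (- {0}) F"
  "closed (range Y)"
proof -
  have cont: "continuous_on (- {0}) (descend \<kappa> Y)"
    using log_periodic_Y has_partials_isCont[OF partials_Y]
    by (intro continuous_descend) (simp_all add: continuous_at_imp_continuous_on)
  show "\<exists>F. nil_conformal_immersion (- {0}) F \<and> nil_minimal (- {0}) F \<and> F ` (- {0}) = range Y \<and>
     (\<exists>H. homeomorphism (- {0}) (range Y) F H) \<and> proper_map_on (- {0}) F"
    using conformal_minimal descend_image proper_descend
      proper_injective_homeomorphism[OF cont proper_descend inj_descend] by auto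
  show "closed (range Y)"
    using proper_map_on_closed_image[OF cont proper_descend, of "- {0}"] descend_image by simp
qed

end

theorem theorem5p6:
  fixes \<alpha> :: real
  assumes "\<alpha> > 0"
  defines "S \<equiv> horizontal_catenoid \<alpha>"
  shows
    \<comment> \<open>minimal annulus, conformally equivalent to C - {0}, properly embedded\<close>
    "(\<exists>F. nil_conformal_immersion (- {0}) F \<and> nil_minimal (- {0}) F \<and>
          F ` (- {0}) = S \<and> (\<exists>H. homeomorphism (- {0}) S F H) \<and> proper_map_on (- {0}) F)
     \<and> closed S
     \<comment> \<open>1. sections by vertical planes x2 = c are nonempty closed embedded convex curves\<close>
     \<and> (\<forall>c. vslice c S \<noteq> {} \<and>
            (\<exists>\<gamma>. simple_path \<gamma> \<and> pathfinish \<gamma> = pathstart \<gamma> \<and> path_image \<gamma> = vslice c S) \<and>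
            (\<exists>D. convex D \<and> compact D \<and> interior D \<noteq> {} \<and> frontier D = vslice c S))
     \<comment> \<open>3. symmetries\<close>
     \<and> (\<lambda>p. vector [p$1, - p$2, - p$3]) ` S = S
     \<and> (\<lambda>p. vector [- p$1, p$2, - p$3]) ` S = S
     \<and> (\<lambda>p. vector [- p$1, - p$2, p$3]) ` S = S
     \<and> (\<forall>c. plane_coords c (vector [0, c, 0]) \<in> inside (vslice c S))"
proof -
  obtain h b where data: "hc_CC \<alpha> > 0" "h > 0"
    "\<And>u. (hc_phi \<alpha> has_real_derivative (cos (hc_phi \<alpha> u))^2 * hc_Gp \<alpha> u - \<alpha>) (at u)"
    "\<And>u. (cos (hc_phi \<alpha> u))^2 * hc_Gp \<alpha> u < \<alpha>"
    "\<And>u. (hc_Gp \<alpha> has_real_derivative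
       ((hc_Gp \<alpha> u)^2 + (hc_CC \<alpha>)^2) * sin (hc_phi \<alpha> u) * cos (hc_phi \<alpha> u)) (at u)"
    "\<And>u. (hc_beta \<alpha> has_real_derivative hc_CC \<alpha> * (cos (hc_phi \<alpha> u))^2) (at u)"
    "\<And>u. (hc_G \<alpha> has_real_derivative hc_Gp \<alpha> u) (at u)"
    "\<And>u. hc_phi \<alpha> (u + h) = hc_phi \<alpha> u - pi" "\<And>u. hc_Gp \<alpha> (u + h) = hc_Gp \<alpha> u"
    "\<And>u. hc_beta \<alpha> (u + h) = hc_beta \<alpha> u + b" "\<And>u. hc_G \<alpha> (u + h) = hc_G \<alpha> u - hc_CC \<alpha> * b / \<alpha>"
    "\<And>u. hc_phi \<alpha> (- u) = - hc_phi \<alpha> u" "\<And>u. hc_Gp \<alpha> (- u) = hc_Gp \<alpha> u"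
    "\<And>u. hc_beta \<alpha> (- u) = - hc_beta \<alpha> u" "\<And>u. hc_G \<alpha> (- u) = - hc_G \<alpha> u"
    by (rule hc_profile_functions[OF assms(1)]) (rule that)
  interpret nil_catenoid \<alpha> "hc_CC \<alpha>" h b "hc_phi \<alpha>" "hc_Gp \<alpha>" "hc_beta \<alpha>" "hc_G \<alpha>"
    by unfold_locales (fact assms(1) data)+
  have Y_hc: "Y w = hc_X \<alpha> (Re w) (Im w)" for w
    by (simp only: Y_def hc_X_def X1_def X2_def Q_def A_def Let_def add_diff_eq)
  have S: "S = range Y"
  proof (intro equalityI subsetI)
    fix p assume "p \<in> S"
    then obtain u v where "p = hc_X \<alpha> u v" by (auto simp: S_def horizontal_catenoid_def)
    then have "p = Y (Complex u v)" by (simp add: Y_hc)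
    then show "p \<in> range Y" by simp
  next
    fix p assume "p \<in> range Y"
    then show "p \<in> S" by (auto simp: S_def horizontal_catenoid_def Y_hc)
  qed
  \<comment> \<open>The axis meets each plane in the centre of symmetry of the section.\<close>
  have origin: "plane_coords c (vector [0, c, 0]) = 0" for c
    by (simp add: plane_coords_def zero_prod_def)
  show ?thesis
    unfolding S vslice_eq origin
  proof (intro conjI allI)
    show "\<exists>F. nil_conformal_immersion (- {0}) F \<and> nil_minimal (- {0}) F \<and>
        F ` (- {0}) = range Y \<and> (\<exists>H. homeomorphism (- {0}) (range Y) F H) \<and> proper_map_on (- {0}) F"
      "closed (range Y)"
      by (fact annulus)+
    show "range (\<gamma> c) \<noteq> {}" for c by simp
    show "\<exists>p. simple_path p \<and> pathfinish p = pathstart p \<and> path_image p = range (\<gamma> c)" for c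
      by (rule turning_curve.simple_closed_path[OF turning])
    show "\<exists>D. convex D \<and> compact D \<and> interior D \<noteq> {} \<and> frontier D = range (\<gamma> c)" for c
      by (rule turning_curve.convex_region[OF turning])
    show "0 \<in> inside (range (\<gamma> c))" for c
      by (rule turning_curve.zero_in_inside[OF turning])
  qed (fact Y_rotations)+
qed

end
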